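(* Let $\mathcal{D}$ be a regular ultrafilter on a set $I$ with $|I|=\lambda$ (an infinite cardinal) which is flexible and good for the random graph. Suppose $(T,\varphi(\bar x,\bar y))$ has the pseudo-nfcp and $M\models T$. Then the ultrapower $M^I/\mathcal{D}$ is $\lambda^+$-saturated for positive $\varphi$-types.
   Context: $T$ is a complete countable first-order theory with monster model $\mathfrak{C}_T$, and $\varphi(\bar x,\bar y)$ is a formula of its language. **Pseudo-nfcp.** Let $\mathcal{P}$ be the set of complete types $p(\bar y)$ over $\emptyset$ (in $\ell(\bar y)$ variables) containing the formula $\exists\bar x\,\varphi(\bar x,\bar y)$. $(T,\varphi)$ has the pseudo-nfcp when $T$ is countable and one can assign to each $p\in\mathcal{P}$ a function $f_p:\omega\to\omega$ such that, writing $f_{\bar a}$ for $f_p$ when $p=\mathrm{tp}(\bar a)\in\mathcal{P}$: (1) (continuity) for each $m<\omega$ and $p\in\mathcal P$, if $f_p(m)=r$ then for some $\psi(\bar y)\in p$, every $q\in\mathcal{P}$ with $\psi\in q$ satisfies $f_q(m)=r$; (2) for every $s\ge1$ there is $n<\omega$ such that whenever $\bar a_0,\dots,\bar a_{s-1},\bar b_0,\dots,\bar b_{s-1}$ are tuples from $\mathfrak{C}_T$ realizing types in $\mathcal{P}$ with $f_{\bar a_\ell}\upharpoonright n=f_{\bar b_\ell}\upharpoonright n$ for all $\ell<s$, and $\{\varphi(\bar x,\bar a_\ell):\ell<s\}$ is a partial type (i.e. consistent), then $\{\varphi(\bar x,\bar b_\ell):\ell<s\}$ is also a partial type. **Regular.**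 $\mathcal{D}$ on $I$, $|I|=\lambda$, is regular if there is $\{X_\alpha:\alpha<\lambda\}\subseteq\mathcal{D}$ such that each $i\in I$ belongs to only finitely many $X_\alpha$ (a regularizing family). **Flexible.** $\mathcal{D}$ is flexible if for every sequence $\langle n_i:i\in I\rangle$ of natural numbers with $\prod_{i\in I}n_i/\mathcal{D}>\aleph_0$ (i.e. $\langle n_i : i \in I\rangle/\mathcal{D}$ is a nonstandard integer) there is $\{X_\alpha:\alpha<\lambda\}\subseteq\mathcal{D}$ such that $|\{\alpha<\lambda:i\in X_\alpha\}|\le n_i$ for all $i\in I$. **Good for the random graph.** A regular ultrafilter $\mathcal{D}$ on $I$, $|I|=\lambda$, is good for the random graph iff for any infinite $M$ and any $A,B\subseteq M^I/\mathcal{D}$ with $|A|+|B|\le\lambda$ and $A\cap B=\emptyset$, there is an internal predicate $P$ (i.e. $P=\prod_{i\in I}P_i/\mathcal{D}$ with $P_i\subseteq M$) such that $A\subseteq P$ and $B\cap P=\emptyset$. (Equivalently, ultrapowers by $\mathcal D$ of models of the theory of the random graph are $\lambda^+$-saturated.) **$\lambda^+$-saturated for positive $\varphi$-types** means: every consistent (finitely satisfiable) set of the form $\{\varphi(\bar x,\bar a_\alpha):\alpha<\lambda\}$ with parameters $\bar a_\alpha$ from $M^I/\mathcal{D}$ is realized in $M^I/\mathcal{D}$. *)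

theory Defs
  imports "HOL-Library.FuncSet" "HOL-Library.Countable_Set"
begin

unbundle cardinal_syntax

section \<open>First-order languages, formulas and structures\<close>

text \<open>The symbols of a language are subsets of the types \<open>'f\<close> and \<open>'r\<close>, so that languages without
  function symbols or without relation symbols are allowed. Constants are function symbols of arity 0.\<close>

record ('f, 'r) lang =
  fsyms :: "'f set"
  rsyms :: "'r set"
  farity :: "'f \<Rightarrow> nat"
  rarity :: "'r \<Rightarrow> nat"

definition countable_lang :: "('f, 'r) lang \<Rightarrow> bool" where
  "countable_lang L \<longleftrightarrow> countable (fsyms L) \<and> countable (rsyms L)"

datatype 'f trm = Var nat | Fn 'f "'f trm list"

datatype ('f, 'r) fm =
    Eq "'f trm" "'f trm"
  | Rl 'r "'f trm list"
  | Neg "('f, 'r) fm"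
  | Conj "('f, 'r) fm" "('f, 'r) fm"
  | Ex nat "('f, 'r) fm"

fun fvt :: "'f trm \<Rightarrow> nat set" where
  "fvt (Var n) = {n}"
| "fvt (Fn f ts) = (\<Union>t\<in>set ts. fvt t)"

fun fv :: "('f, 'r) fm \<Rightarrow> nat set" where
  "fv (Eq s t) = fvt s \<union> fvt t"
| "fv (Rl r ts) = (\<Union>t\<in>set ts. fvt t)"
| "fv (Neg \<phi>) = fv \<phi>"
| "fv (Conj \<phi> \<psi>) = fv \<phi> \<union> fv \<psi>"
| "fv (Ex n \<phi>) = fv \<phi> - {n}"

fun wf_trm :: "('f, 'r) lang \<Rightarrow> 'f trm \<Rightarrow> bool" where
  "wf_trm L (Var n) \<longleftrightarrow> True"
| "wf_trm L (Fn f ts) \<longleftrightarrow> f \<in> fsyms L \<and> length ts = farity L f \<and> (\<forall>t\<in>set ts. wf_trm L t)"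

fun wf_fm :: "('f, 'r) lang \<Rightarrow> ('f, 'r) fm \<Rightarrow> bool" where
  "wf_fm L (Eq s t) \<longleftrightarrow> wf_trm L s \<and> wf_trm L t"
| "wf_fm L (Rl r ts) \<longleftrightarrow> r \<in> rsyms L \<and> length ts = rarity L r \<and> (\<forall>t\<in>set ts. wf_trm L t)"
| "wf_fm L (Neg \<phi>) \<longleftrightarrow> wf_fm L \<phi>"
| "wf_fm L (Conj \<phi> \<psi>) \<longleftrightarrow> wf_fm L \<phi> \<and> wf_fm L \<psi>"
| "wf_fm L (Ex n \<phi>) \<longleftrightarrow> wf_fm L \<phi>"

definition formulas :: "('f, 'r) lang \<Rightarrow> nat set \<Rightarrow> ('f, 'r) fm set" where
  "formulas L V = {\<phi>. wf_fm L \<phi> \<and> fv \<phi> \<subseteq> V}"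

abbreviation sentences :: "('f, 'r) lang \<Rightarrow> ('f, 'r) fm set" where
  "sentences L \<equiv> formulas L {}"

abbreviation Exs :: "nat list \<Rightarrow> ('f, 'r) fm \<Rightarrow> ('f, 'r) fm" where
  "Exs xs \<phi> \<equiv> foldr Ex xs \<phi>"

record ('a, 'f, 'r) struct =
  univ :: "'a set"
  fint :: "'f \<Rightarrow> 'a list \<Rightarrow> 'a"
  rint :: "'r \<Rightarrow> 'a list \<Rightarrow> bool"

definition is_struct :: "('f, 'r) lang \<Rightarrow> ('a, 'f, 'r) struct \<Rightarrow> bool" where
  "is_struct L N \<longleftrightarrow> univ N \<noteq> {} \<and>
    (\<forall>f\<in>fsyms L. \<forall>as. length as = farity L f \<and> set as \<subseteq> univ N \<longrightarrow> fint N f as \<in> univ N)"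

text \<open>A tuple indexed by a finite list of variables is represented by a valuation of all variables;
  only its values at the variables of the list matter.\<close>

definition valuations :: "('a, 'f, 'r) struct \<Rightarrow> (nat \<Rightarrow> 'a) set" where
  "valuations N = UNIV \<rightarrow> univ N"

fun tval :: "('a, 'f, 'r) struct \<Rightarrow> (nat \<Rightarrow> 'a) \<Rightarrow> 'f trm \<Rightarrow> 'a" where
  "tval N v (Var n) = v n"
| "tval N v (Fn f ts) = fint N f (map (tval N v) ts)"

fun sat :: "('a, 'f, 'r) struct \<Rightarrow> (nat \<Rightarrow> 'a) \<Rightarrow> ('f, 'r) fm \<Rightarrow> bool" where
  "sat N v (Eq s t) \<longleftrightarrow> tval N v s = tval N v t"
| "sat N v (Rl r ts) \<longleftrightarrow> rint N r (map (tval N v) ts)"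
| "sat N v (Neg \<phi>) \<longleftrightarrow> \<not> sat N v \<phi>"
| "sat N v (Conj \<phi> \<psi>) \<longleftrightarrow> sat N v \<phi> \<and> sat N v \<psi>"
| "sat N v (Ex n \<phi>) \<longleftrightarrow> (\<exists>x\<in>univ N. sat N (v(n := x)) \<phi>)"

definition is_model :: "('f, 'r) lang \<Rightarrow> ('f, 'r) fm set \<Rightarrow> ('a, 'f, 'r) struct \<Rightarrow> bool" where
  "is_model L T N \<longleftrightarrow> is_struct L N \<and> (\<forall>\<sigma>\<in>T. \<forall>v\<in>valuations N. sat N v \<sigma>)"

text \<open>Theories are taken to be deductively closed, so that completeness is membership of every sentence
  or its negation. Consistency is not part of this definition: it follows from the existence of a model.\<close>

definition complete_theory :: "('f, 'r) lang \<Rightarrow> ('f, 'r) fm set \<Rightarrow> bool" where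
  "complete_theory L T \<longleftrightarrow> T \<subseteq> sentences L \<and> (\<forall>\<sigma>\<in>sentences L. \<sigma> \<in> T \<or> Neg \<sigma> \<in> T)"

section \<open>Types\<close>

text \<open>A formula with parameters is a pair \<open>(\<psi>, e)\<close>: the variables of \<open>\<psi>\<close> outside the list \<open>xs\<close> of type
  variables are replaced by the parameters that \<open>e\<close> assigns to them.\<close>

definition realizes ::
  "('a, 'f, 'r) struct \<Rightarrow> nat list \<Rightarrow> (nat \<Rightarrow> 'a) \<Rightarrow> (('f, 'r) fm \<times> (nat \<Rightarrow> 'a)) set \<Rightarrow> bool" where
  "realizes N xs b p \<longleftrightarrow> (\<forall>(\<psi>, e)\<in>p. sat N (override_on e b (set xs)) \<psi>)"

definition realized ::
  "('a, 'f, 'r) struct \<Rightarrow> nat list \<Rightarrow> (('f, 'r) fm \<times> (nat \<Rightarrow> 'a)) set \<Rightarrow> bool" where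
  "realized N xs p \<longleftrightarrow> (\<exists>b\<in>valuations N. realizes N xs b p)"

definition partial_type ::
  "('a, 'f, 'r) struct \<Rightarrow> nat list \<Rightarrow> (('f, 'r) fm \<times> (nat \<Rightarrow> 'a)) set \<Rightarrow> bool" where
  "partial_type N xs p \<longleftrightarrow> (\<forall>F\<subseteq>p. finite F \<longrightarrow> realized N xs F)"

text \<open>Complete types over the empty set. When \<open>N\<close> is a model of a complete theory \<open>T\<close>, a set of formulas
  is consistent with \<open>T\<close> iff it is finitely satisfiable in \<open>N\<close>. The valuation paired with each formula
  is irrelevant, since all free variables are among \<open>ys\<close>.\<close>

definition complete_types ::
  "('f, 'r) lang \<Rightarrow> ('a, 'f, 'r) struct \<Rightarrow> nat list \<Rightarrow> ('f, 'r) fm set set" where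
  "complete_types L N ys = {p. p \<subseteq> formulas L (set ys) \<and>
     partial_type N ys (p \<times> valuations N) \<and>
     (\<forall>\<psi>\<in>formulas L (set ys). \<psi> \<in> p \<or> Neg \<psi> \<in> p)}"

definition tp ::
  "('f, 'r) lang \<Rightarrow> ('a, 'f, 'r) struct \<Rightarrow> nat list \<Rightarrow> (nat \<Rightarrow> 'a) \<Rightarrow> ('f, 'r) fm set" where
  "tp L N ys a = {\<psi>\<in>formulas L (set ys). sat N a \<psi>}"

section \<open>Monster models\<close>

definition saturated ::
  "'k rel \<Rightarrow> ('f, 'r) lang \<Rightarrow> ('a, 'f, 'r) struct \<Rightarrow> bool" where
  "saturated \<kappa> L N \<longleftrightarrow>
    (\<forall>A xs p. A \<subseteq> univ N \<and> |A| <o \<kappa> \<and>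
       (\<forall>(\<psi>, e)\<in>p. wf_fm L \<psi> \<and> e \<in> valuations N \<and> e ` (fv \<psi> - set xs) \<subseteq> A) \<and>
       partial_type N xs p \<longrightarrow> realized N xs p)"

definition partial_elementary ::
  "('f, 'r) lang \<Rightarrow> ('a, 'f, 'r) struct \<Rightarrow> 'a set \<Rightarrow> ('a \<Rightarrow> 'a) \<Rightarrow> bool" where
  "partial_elementary L N A g \<longleftrightarrow> A \<subseteq> univ N \<and> g ` A \<subseteq> univ N \<and>
    (\<forall>\<psi> e. wf_fm L \<psi> \<and> e ` fv \<psi> \<subseteq> A \<longrightarrow> (sat N e \<psi> \<longleftrightarrow> sat N (g \<circ> e) \<psi>))"

definition automorphism ::
  "('f, 'r) lang \<Rightarrow> ('a, 'f, 'r) struct \<Rightarrow> ('a \<Rightarrow> 'a) \<Rightarrow> bool" where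
  "automorphism L N h \<longleftrightarrow> bij_betw h (univ N) (univ N) \<and>
    (\<forall>f\<in>fsyms L. \<forall>as. length as = farity L f \<and> set as \<subseteq> univ N \<longrightarrow>
       h (fint N f as) = fint N f (map h as)) \<and>
    (\<forall>r\<in>rsyms L. \<forall>as. length as = rarity L r \<and> set as \<subseteq> univ N \<longrightarrow>
       (rint N r as \<longleftrightarrow> rint N r (map h as)))"

definition strongly_homogeneous ::
  "'k rel \<Rightarrow> ('f, 'r) lang \<Rightarrow> ('a, 'f, 'r) struct \<Rightarrow> bool" where
  "strongly_homogeneous \<kappa> L N \<longleftrightarrow>
    (\<forall>A g. |A| <o \<kappa> \<and> partial_elementary L N A g \<longrightarrow>
       (\<exists>h. automorphism L N h \<and> (\<forall>a\<in>A. h a = g a)))"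

text \<open>The bound \<open>\<kappa>\<close> on small sets is an arbitrary uncountable cardinal; the usual convention that \<open>\<kappa>\<close>
  also exceeds every other cardinal under consideration is a special case.\<close>

definition monster_model ::
  "'k rel \<Rightarrow> ('f, 'r) lang \<Rightarrow> ('f, 'r) fm set \<Rightarrow> ('a, 'f, 'r) struct \<Rightarrow> bool" where
  "monster_model \<kappa> L T C \<longleftrightarrow> Card_order \<kappa> \<and> natLeq <o \<kappa> \<and>
     is_model L T C \<and> saturated \<kappa> L C \<and> strongly_homogeneous \<kappa> L C"

section \<open>Pseudo-nfcp\<close>

definition phi_types ::
  "('f, 'r) lang \<Rightarrow> ('a, 'f, 'r) struct \<Rightarrow> ('f, 'r) fm \<Rightarrow> nat list \<Rightarrow> nat list \<Rightarrow> ('f, 'r) fm set set" where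
  "phi_types L C \<phi> xs ys = {p \<in> complete_types L C ys. Exs xs \<phi> \<in> p}"

definition pseudo_nfcp ::
  "('f, 'r) lang \<Rightarrow> ('a, 'f, 'r) struct \<Rightarrow> ('f, 'r) fm \<Rightarrow> nat list \<Rightarrow> nat list \<Rightarrow> bool" where
  "pseudo_nfcp L C \<phi> xs ys \<longleftrightarrow> countable_lang L \<and>
    (\<exists>f :: ('f, 'r) fm set \<Rightarrow> nat \<Rightarrow> nat.
      (\<forall>m. \<forall>p\<in>phi_types L C \<phi> xs ys. \<forall>r. f p m = r \<longrightarrow>
         (\<exists>\<psi>\<in>p. \<forall>q\<in>phi_types L C \<phi> xs ys. \<psi> \<in> q \<longrightarrow> f q m = r)) \<and>
      (\<forall>s\<ge>1. \<exists>n. \<forall>a b :: nat \<Rightarrow> nat \<Rightarrow> 'a.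
         (\<forall>l<s. a l \<in> valuations C \<and> b l \<in> valuations C \<and>
            tp L C ys (a l) \<in> phi_types L C \<phi> xs ys \<and>
            tp L C ys (b l) \<in> phi_types L C \<phi> xs ys \<and>
            (\<forall>j<n. f (tp L C ys (a l)) j = f (tp L C ys (b l)) j)) \<and>
         partial_type C xs {(\<phi>, a l) |l. l < s} \<longrightarrow>
         partial_type C xs {(\<phi>, b l) |l. l < s}))"

section \<open>Ultrapowers\<close>

definition ultrafilter_on :: "'i set \<Rightarrow> 'i set set \<Rightarrow> bool" where
  "ultrafilter_on I D \<longleftrightarrow> D \<subseteq> Pow I \<and> I \<in> D \<and> {} \<notin> D \<and>
     (\<forall>X\<in>D. \<forall>Y\<in>D. X \<inter> Y \<in> D) \<and>
     (\<forall>X\<in>D. \<forall>Y. X \<subseteq> Y \<and> Y \<subseteq> I \<longrightarrow> Y \<in> D) \<and>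
     (\<forall>X\<subseteq>I. X \<in> D \<or> I - X \<in> D)"

definition ueq :: "'i set \<Rightarrow> 'i set set \<Rightarrow> 'a set \<Rightarrow> ('i \<Rightarrow> 'a) rel" where
  "ueq I D U = {(g, h). g \<in> (I \<rightarrow>\<^sub>E U) \<and> h \<in> (I \<rightarrow>\<^sub>E U) \<and> {i\<in>I. g i = h i} \<in> D}"

definition ucls :: "'i set \<Rightarrow> 'i set set \<Rightarrow> 'a set \<Rightarrow> ('i \<Rightarrow> 'a) \<Rightarrow> ('i \<Rightarrow> 'a) set" where
  "ucls I D U g = ueq I D U `` {g}"

definition upower :: "'i set \<Rightarrow> 'i set set \<Rightarrow> 'a set \<Rightarrow> ('i \<Rightarrow> 'a) set set" where
  "upower I D U = (I \<rightarrow>\<^sub>E U) // ueq I D U"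

definition urep :: "('i \<Rightarrow> 'a) set \<Rightarrow> 'i \<Rightarrow> 'a" where
  "urep c = (SOME g. g \<in> c)"

definition ultrapower ::
  "'i set \<Rightarrow> 'i set set \<Rightarrow> ('a, 'f, 'r) struct \<Rightarrow> (('i \<Rightarrow> 'a) set, 'f, 'r) struct" where
  "ultrapower I D M =
    \<lparr>univ = upower I D (univ M),
     fint = (\<lambda>f cs. ucls I D (univ M) (\<lambda>i\<in>I. fint M f (map (\<lambda>c. urep c i) cs))),
     rint = (\<lambda>r cs. {i\<in>I. rint M r (map (\<lambda>c. urep c i) cs)} \<in> D)\<rparr>"

text \<open>The internal subset \<open>(\<Prod>i\<in>I. P i) / D\<close> of an ultrapower.\<close>

definition internal :: "'i set \<Rightarrow> 'i set set \<Rightarrow> 'a set \<Rightarrow> ('i \<Rightarrow> 'a set) \<Rightarrow> ('i \<Rightarrow> 'a) set set" where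
  "internal I D U P = {c \<in> upower I D U. \<exists>g\<in>c. {i\<in>I. g i \<in> P i} \<in> D}"

section \<open>Properties of ultrafilters\<close>

text \<open>A cardinal \<open>\<lambda>\<close> is a cardinal order \<open>lam\<close>; families indexed by the ordinals below \<open>\<lambda>\<close> are indexed by
  \<open>Field lam\<close>. The families
  \<open>X\<close> below need not be injective: indices are counted, not sets.\<close>

definition regular :: "'i set \<Rightarrow> 'i set set \<Rightarrow> 'l rel \<Rightarrow> bool" where
  "regular I D lam \<longleftrightarrow> (\<exists>X :: 'l \<Rightarrow> 'i set.
     (\<forall>\<alpha>\<in>Field lam. X \<alpha> \<in> D) \<and> (\<forall>i\<in>I. finite {\<alpha>\<in>Field lam. i \<in> X \<alpha>}))"

text \<open>The class of \<open>n\<close> in the ultrapower of the natural numbers is nonstandard: it differs from the class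
  of every constant sequence.\<close>

definition nonstandard :: "'i set \<Rightarrow> 'i set set \<Rightarrow> ('i \<Rightarrow> nat) \<Rightarrow> bool" where
  "nonstandard I D n \<longleftrightarrow> (\<forall>k. {i\<in>I. n i = k} \<notin> D)"

definition flexible :: "'i set \<Rightarrow> 'i set set \<Rightarrow> 'l rel \<Rightarrow> bool" where
  "flexible I D lam \<longleftrightarrow> (\<forall>n. nonstandard I D n \<longrightarrow> (\<exists>X :: 'l \<Rightarrow> 'i set.
     (\<forall>\<alpha>\<in>Field lam. X \<alpha> \<in> D) \<and>
     (\<forall>i\<in>I. finite {\<alpha>\<in>Field lam. i \<in> X \<alpha>} \<and> card {\<alpha>\<in>Field lam. i \<in> X \<alpha>} \<le> n i)))"

text \<open>HOL cannot quantify over sets of all types inside a formula, hence the type argument. For regular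
  ultrafilters the case \<open>'u = nat\<close> implies all others, see \<open>good_for_random_graph_any_type\<close> below.\<close>

definition good_for_random_graph ::
  "'u itself \<Rightarrow> 'i set \<Rightarrow> 'i set set \<Rightarrow> 'l rel \<Rightarrow> bool" where
  "good_for_random_graph (_ :: 'u itself) I D lam \<longleftrightarrow>
    (\<forall>U :: 'u set. infinite U \<longrightarrow>
      (\<forall>A B. A \<subseteq> upower I D U \<and> B \<subseteq> upower I D U \<and> |A| +c |B| \<le>o lam \<and> A \<inter> B = {} \<longrightarrow>
        (\<exists>P. (\<forall>i\<in>I. P i \<subseteq> U) \<and> A \<subseteq> internal I D U P \<and> B \<inter> internal I D U P = {})))"

section \<open>Saturation for positive types\<close>

definition saturated_for_positive_types ::
  "'l rel \<Rightarrow> ('a, 'f, 'r) struct \<Rightarrow> ('f, 'r) fm \<Rightarrow> nat list \<Rightarrow> bool" where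
  "saturated_for_positive_types lam N \<phi> xs \<longleftrightarrow>
    (\<forall>a :: 'l \<Rightarrow> nat \<Rightarrow> 'a. (\<forall>\<alpha>\<in>Field lam. a \<alpha> \<in> valuations N) \<and>
       partial_type N xs {(\<phi>, a \<alpha>) |\<alpha>. \<alpha> \<in> Field lam} \<longrightarrow>
       realized N xs {(\<phi>, a \<alpha>) |\<alpha>. \<alpha> \<in> Field lam})"

section \<open>Independence of the type in goodness for the random graph\<close>

lemma ultrafilter_on_mono:
  assumes "ultrafilter_on I D" "X \<in> D" "X \<subseteq> Y" "Y \<subseteq> I"
  shows "Y \<in> D"
  using assms unfolding ultrafilter_on_def by blast

lemma ultrafilter_on_Int:
  assumes "ultrafilter_on I D" "X \<in> D" "Y \<in> D"
  shows "X \<inter> Y \<in> D"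
  using assms unfolding ultrafilter_on_def by blast

lemma equiv_ueq:
  assumes D: "ultrafilter_on I D"
  shows "equiv (I \<rightarrow>\<^sub>E U) (ueq I D U)"
proof (rule equivI)
  have ID: "I \<in> D" using D by (simp add: ultrafilter_on_def)
  show "ueq I D U \<subseteq> (I \<rightarrow>\<^sub>E U) \<times> (I \<rightarrow>\<^sub>E U)" by (auto simp: ueq_def)
  show "refl_on (I \<rightarrow>\<^sub>E U) (ueq I D U)" using ID by (auto simp: refl_on_def ueq_def)
  show "sym (ueq I D U)" by (auto simp: sym_def ueq_def eq_commute)
  show "trans (ueq I D U)"
  proof (rule transI)
    fix f g h assume 1: "(f, g) \<in> ueq I D U" "(g, h) \<in> ueq I D U"
    then have "{i\<in>I. f i = g i} \<inter> {i\<in>I. g i = h i} \<in> D"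
      by (intro ultrafilter_on_Int[OF D]) (auto simp: ueq_def)
    then have "{i\<in>I. f i = h i} \<in> D"
      by (rule ultrafilter_on_mono[OF D]) auto
    with 1 show "(f, h) \<in> ueq I D U" by (simp add: ueq_def)
  qed
qed

lemma urep_in:
  assumes D: "ultrafilter_on I D" and c: "c \<in> upower I D U"
  shows "urep c \<in> c" "urep c \<in> I \<rightarrow>\<^sub>E U" "ucls I D U (urep c) = c"
proof -
  note eq = equiv_ueq[OF D, of U]
  have "c \<noteq> {}" using c eq by (auto simp: upower_def dest: in_quotient_imp_non_empty)
  then show 1: "urep c \<in> c" unfolding urep_def by (simp add: some_in_eq)
  then show "urep c \<in> I \<rightarrow>\<^sub>E U" using c eq in_quotient_imp_subset unfolding upower_def by blast
  obtain g where g: "c = ueq I D U `` {g}" using c by (auto simp: upower_def elim: quotientE)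
  with 1 have "(g, urep c) \<in> ueq I D U" by simp
  with equiv_class_eq[OF eq this] g show "ucls I D U (urep c) = c" by (simp add: ucls_def)
qed

lemma ucls_in_upower: "g \<in> I \<rightarrow>\<^sub>E U \<Longrightarrow> ucls I D U g \<in> upower I D U"
  by (simp add: ucls_def upower_def quotientI)

lemma ucls_eq_iff:
  assumes D: "ultrafilter_on I D" and "g \<in> I \<rightarrow>\<^sub>E U" "h \<in> I \<rightarrow>\<^sub>E U"
  shows "ucls I D U g = ucls I D U h \<longleftrightarrow> {i\<in>I. g i = h i} \<in> D"
  using eq_equiv_class_iff[OF equiv_ueq[OF D] assms(2,3)] assms(2,3)
  by (simp add: ucls_def ueq_def)

lemma ucls_internal_iff:
  assumes D: "ultrafilter_on I D" and g: "g \<in> I \<rightarrow>\<^sub>E U"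
  shows "ucls I D U g \<in> internal I D U P \<longleftrightarrow> {i\<in>I. g i \<in> P i} \<in> D"
proof
  assume "ucls I D U g \<in> internal I D U P"
  then obtain h where h: "(g, h) \<in> ueq I D U" "{i\<in>I. h i \<in> P i} \<in> D"
    by (auto simp: internal_def ucls_def)
  then have "{i\<in>I. g i = h i} \<inter> {i\<in>I. h i \<in> P i} \<in> D"
    by (intro ultrafilter_on_Int[OF D]) (auto simp: ueq_def)
  then show "{i\<in>I. g i \<in> P i} \<in> D" by (rule ultrafilter_on_mono[OF D]) auto
next
  assume P: "{i\<in>I. g i \<in> P i} \<in> D"
  have "g \<in> ucls I D U g"
    using equiv_ueq[OF D, of U] g unfolding ucls_def by (rule equiv_class_self)
  with P ucls_in_upower[OF g] show "ucls I D U g \<in> internal I D U P"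
    by (auto simp: internal_def)
qed

lemma good_for_random_graph_any_type:
  fixes I :: "'i set" and lam :: "'l rel"
  assumes lam: "Card_order lam" and D: "ultrafilter_on I D" and reg: "regular I D lam"
    and good: "good_for_random_graph TYPE(nat) I D lam"
  shows "good_for_random_graph TYPE('u) I D lam"
  unfolding good_for_random_graph_def
proof (intro allI impI)
  fix U :: "'u set" and A B
  assume "infinite U"
    and *: "A \<subseteq> upower I D U \<and> B \<subseteq> upower I D U \<and> |A| +c |B| \<le>o lam \<and> A \<inter> B = {}"
  obtain X :: "'l \<Rightarrow> 'i set" where X: "\<And>\<alpha>. \<alpha> \<in> Field lam \<Longrightarrow> X \<alpha> \<in> D"
    and fin: "\<And>i. i \<in> I \<Longrightarrow> finite {\<alpha>\<in>Field lam. i \<in> X \<alpha>}"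
    using reg unfolding regular_def by blast
  have "|A \<union> B| \<le>o lam"
    using * Un_csum[of A B] ordLeq_transitive by blast
  then have "|A \<union> B| \<le>o |Field lam|"
    using card_of_Field_ordIso[OF lam] ordIso_symmetric ordLeq_ordIso_trans by blast
  then obtain k where k: "inj_on k (A \<union> B)" "k ` (A \<union> B) \<subseteq> Field lam"
    unfolding card_of_ordLeq[symmetric] by blast
  define S where "S i = (\<lambda>c. urep c i) ` {c \<in> A \<union> B. i \<in> X (k c)}" for i
  have finS: "finite (S i)" if "i \<in> I" for i
  proof -
    have "k ` {c \<in> A \<union> B. i \<in> X (k c)} \<subseteq> {\<alpha>\<in>Field lam. i \<in> X \<alpha>}" using k by auto
    then have "finite (k ` {c \<in> A \<union> B. i \<in> X (k c)})" using fin[OF that] finite_subset by blast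
    moreover have "inj_on k {c \<in> A \<union> B. i \<in> X (k c)}" by (rule inj_on_subset[OF k(1)]) auto
    ultimately show ?thesis unfolding S_def by (blast intro: finite_imageD)
  qed
  have "\<exists>g :: 'u \<Rightarrow> nat. i \<in> I \<longrightarrow> inj_on g (S i)" for i
    using finS[of i] finite_imp_inj_to_nat_seg by meson
  then obtain g :: "'i \<Rightarrow> 'u \<Rightarrow> nat" where g: "\<And>i. i \<in> I \<Longrightarrow> inj_on (g i) (S i)" by metis
  define h where "h c = (\<lambda>i\<in>I. g i (urep c i))" for c
  define q where "q c = ucls I D (UNIV :: nat set) (h c)" for c
  have hE: "h c \<in> I \<rightarrow>\<^sub>E UNIV" for c by (auto simp: h_def)
  have XD: "X (k c) \<in> D" if "c \<in> A \<union> B" for c using X k that by blast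
  have up: "c \<in> upower I D U" if "c \<in> A \<union> B" for c using * that by blast
  have inj: "c = d" if cd: "c \<in> A \<union> B" "d \<in> A \<union> B" and eq: "q c = q d" for c d
  proof -
    have "{i\<in>I. h c i = h d i} \<in> D" using eq ucls_eq_iff[OF D hE hE] by (simp add: q_def)
    then have "{i\<in>I. h c i = h d i} \<inter> (X (k c) \<inter> X (k d)) \<in> D"
      using XD cd by (intro ultrafilter_on_Int[OF D]) auto
    then have "{i\<in>I. urep c i = urep d i} \<in> D"
    proof (rule ultrafilter_on_mono[OF D])
      show "{i\<in>I. h c i = h d i} \<inter> (X (k c) \<inter> X (k d)) \<subseteq> {i\<in>I. urep c i = urep d i}"
      proof clarsimp
        fix i assume i: "i \<in> I" "h c i = h d i" "i \<in> X (k c)" "i \<in> X (k d)"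
        have "urep c i \<in> S i" "urep d i \<in> S i" using i cd by (auto simp: S_def)
        then show "urep c i = urep d i" using g[OF i(1)] i by (auto simp: h_def dest: inj_onD)
      qed
    qed auto
    then have "ucls I D U (urep c) = ucls I D U (urep d)"
      using ucls_eq_iff[OF D urep_in(2)[OF D up[OF cd(1)]] urep_in(2)[OF D up[OF cd(2)]]] by simp
    then show "c = d" using urep_in(3)[OF D up[OF cd(1)]] urep_in(3)[OF D up[OF cd(2)]] by simp
  qed
  have "|q ` A| +c |q ` B| \<le>o |A| +c |B|" by (intro csum_mono card_of_image)
  then have "|q ` A| +c |q ` B| \<le>o lam" using * ordLeq_transitive by blast
  moreover have "q ` A \<inter> q ` B = {}" using inj * by blast
  moreover have "q ` A \<subseteq> upower I D UNIV" "q ` B \<subseteq> upower I D UNIV"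
    using ucls_in_upower[OF hE] by (auto simp: q_def)
  moreover note good[unfolded good_for_random_graph_def, THEN spec, THEN mp, OF infinite_UNIV_nat,
    THEN spec, THEN spec, THEN mp, of "q ` A" "q ` B"]
  ultimately have "\<exists>P. (\<forall>i\<in>I. P i \<subseteq> UNIV) \<and> q ` A \<subseteq> internal I D UNIV P \<and>
      q ` B \<inter> internal I D UNIV P = {}"
    by simp
  then obtain P where P: "q ` A \<subseteq> internal I D UNIV P" "q ` B \<inter> internal I D UNIV P = {}"
    by (elim exE conjE)
  define R where "R i = {u \<in> U. g i u \<in> P i}" for i
  have "c \<in> internal I D U R \<longleftrightarrow> q c \<in> internal I D UNIV P" if c: "c \<in> A \<union> B" for c
  proof -
    have "{i\<in>I. urep c i \<in> R i} = {i\<in>I. h c i \<in> P i}"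
      using urep_in(2)[OF D up[OF c]] by (auto simp: R_def h_def)
    then show ?thesis
      using ucls_internal_iff[OF D urep_in(2)[OF D up[OF c]], of R] urep_in(3)[OF D up[OF c]]
        ucls_internal_iff[OF D hE, of c P] by (simp add: q_def)
  qed
  then have "A \<subseteq> internal I D U R" "B \<inter> internal I D U R = {}" using P by blast+
  moreover have "\<forall>i\<in>I. R i \<subseteq> U" by (auto simp: R_def)
  ultimately show "\<exists>P. (\<forall>i\<in>I. P i \<subseteq> U) \<and> A \<subseteq> internal I D U P \<and> B \<inter> internal I D U P = {}"
    by blast
qed

end

(* Let a_\<alpha> (\<alpha> < \<lambda>) be the parameters in the ultrapower and let n(s) be given by clause (2) of the
   pseudo-nfcp. By continuity and Los's theorem, for each standard s the functions f attached to
   a_\<alpha>[i] and to a_\<alpha> agree below n(s) for almost all i; so the largest s up to which they agree at i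
   defines a nonstandard integer t_\<alpha>. Goodness for the random graph, applied to the standard integers
   and the t_\<alpha>, yields a single nonstandard s below all t_\<alpha>. Flexibility for s distributes the formulas
   so that at most s_i of them are to be solved at the index i. Any s_i parameters from the ultrapower
   have a consistent set of instances, and those at i have f-values agreeing with them below n(s_i),
   so clause (2), transferred through the monster model, provides a solution in M at i. *)

theory Submission
  imports Defs
begin

section \<open>Satisfaction and renaming of variables\<close>

lemma finite_fvt: "finite (fvt t)"
  by (induction t) auto

lemma finite_fv: "finite (fv \<psi>)"
  by (induction \<psi>) (auto simp: finite_fvt)

lemma tval_cong: "(\<And>n. n \<in> fvt t \<Longrightarrow> v n = w n) \<Longrightarrow> tval N v t = tval N w t"
proof (induction t)
  case (Fn f ts)
  then have *: "map (tval N v) ts = map (tval N w) ts" by auto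
  show ?case by (simp only: tval.simps *)
qed simp

lemma sat_cong: "(\<And>n. n \<in> fv \<psi> \<Longrightarrow> v n = w n) \<Longrightarrow> sat N v \<psi> \<longleftrightarrow> sat N w \<psi>"
proof (induction \<psi> arbitrary: v w)
  case (Eq s t)
  then have "tval N v s = tval N w s" "tval N v t = tval N w t"
    by (auto intro!: tval_cong)
  then show ?case by simp
next
  case (Rl r ts)
  then have *: "map (tval N v) ts = map (tval N w) ts" by (auto intro!: tval_cong)
  show ?case by (simp only: sat.simps *)
next
  case (Neg \<psi>)
  have "sat N v \<psi> \<longleftrightarrow> sat N w \<psi>" by (rule Neg.IH) (simp add: Neg.prems)
  then show ?case by simp
next
  case (Conj \<psi>1 \<psi>2)
  have "sat N v \<psi>1 \<longleftrightarrow> sat N w \<psi>1" "sat N v \<psi>2 \<longleftrightarrow> sat N w \<psi>2"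
    by (rule Conj.IH; simp add: Conj.prems)+
  then show ?case by simp
next
  case (Ex n \<psi>)
  have "sat N (v(n := x)) \<psi> \<longleftrightarrow> sat N (w(n := x)) \<psi>" for x
    by (rule Ex.IH) (use Ex.prems in auto)
  then show ?case by simp
qed

section \<open>Quantifier blocks and finite conjunctions\<close>

lemma valuations_upd: "v \<in> valuations N \<Longrightarrow> x \<in> univ N \<Longrightarrow> v(n := x) \<in> valuations N"
  by (auto simp: valuations_def)

lemma override_on_valuations:
  "v \<in> valuations N \<Longrightarrow> b \<in> valuations N \<Longrightarrow> override_on v b X \<in> valuations N"
  by (simp add: valuations_def override_on_def Pi_iff)

text \<open>Links a block of quantifiers, which picks values one at a time, with
  \<open>realized\<close>, which picks all values on \<open>xs\<close> at once through a
  valuation.\<close>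

lemma sat_Exs:
  assumes "v \<in> valuations N"
  shows "sat N v (Exs xs \<psi>) \<longleftrightarrow> (\<exists>b\<in>valuations N. sat N (override_on v b (set xs)) \<psi>)"
  using assms
proof (induction xs arbitrary: v)
  case (Cons x xs)
  have "sat N v (Exs (x # xs) \<psi>) \<longleftrightarrow>
      (\<exists>c\<in>univ N. \<exists>b\<in>valuations N. sat N (override_on (v(x := c)) b (set xs)) \<psi>)"
    using Cons.IH[OF valuations_upd[OF Cons.prems]] by (simp del: fun_upd_apply)
  also have "\<dots> \<longleftrightarrow> (\<exists>b\<in>valuations N. sat N (override_on v b (set (x # xs))) \<psi>)"
  proof (intro iffI; elim bexE)
    fix c b
    assume c: "c \<in> univ N" "b \<in> valuations N" "sat N (override_on (v(x := c)) b (set xs)) \<psi>"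
    \<comment> \<open>If \<open>x\<close> occurs again in \<open>xs\<close>, the inner quantifier
      overrides \<open>c\<close>, so \<open>b\<close> keeps its own value at
      \<open>x\<close>.\<close>
    define b' where "b' = (if x \<in> set xs then b else b(x := c))"
    have "override_on v b' (set (x # xs)) = override_on (v(x := c)) b (set xs)"
      by (auto simp: b'_def override_on_def fun_eq_iff)
    moreover have "b' \<in> valuations N" using c by (simp add: b'_def valuations_upd)
    ultimately show "\<exists>b\<in>valuations N. sat N (override_on v b (set (x # xs))) \<psi>"
      using c(3) by (intro bexI[of _ b']) simp_all
  next
    fix b
    assume b: "b \<in> valuations N" "sat N (override_on v b (set (x # xs))) \<psi>"
    have "override_on v b (set (x # xs)) = override_on (v(x := b x)) b (set xs)"
      by (auto simp: override_on_def fun_eq_iff)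
    moreover have "b x \<in> univ N" using b by (auto simp: valuations_def)
    ultimately show "\<exists>c\<in>univ N. \<exists>b\<in>valuations N. sat N (override_on (v(x := c)) b (set xs)) \<psi>"
      using b by (intro bexI[of _ "b x"] bexI[of _ b]) (simp_all del: fun_upd_apply)
  qed
  finally show ?case .
qed auto

lemma wf_Exs: "wf_fm L (Exs xs \<psi>) \<longleftrightarrow> wf_fm L \<psi>"
  by (induction xs) auto

lemma fv_Exs: "fv (Exs xs \<psi>) = fv \<psi> - set xs"
  by (induction xs) auto

text \<open>The empty conjunction needs a valid sentence; this one is true because universes are nonempty.\<close>

definition conjs :: "('f, 'r) fm list \<Rightarrow> ('f, 'r) fm" where
  "conjs \<psi>s = foldr Conj \<psi>s (Ex 0 (Eq (Var 0) (Var 0)))"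

lemma wf_conjs: "wf_fm L (conjs \<psi>s) \<longleftrightarrow> (\<forall>\<psi>\<in>set \<psi>s. wf_fm L \<psi>)"
  by (induction \<psi>s) (auto simp: conjs_def)

lemma fv_conjs: "fv (conjs \<psi>s) = (\<Union>\<psi>\<in>set \<psi>s. fv \<psi>)"
  by (induction \<psi>s) (auto simp: conjs_def)

lemma sat_conjs: "univ N \<noteq> {} \<Longrightarrow> sat N v (conjs \<psi>s) \<longleftrightarrow> (\<forall>\<psi>\<in>set \<psi>s. sat N v \<psi>)"
  by (induction \<psi>s) (auto simp: conjs_def)

section \<open>Capture-avoiding renaming of variables\<close>

fun rename_trm :: "(nat \<Rightarrow> nat) \<Rightarrow> 'f trm \<Rightarrow> 'f trm" where
  "rename_trm \<rho> (Var n) = Var (\<rho> n)"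
| "rename_trm \<rho> (Fn f ts) = Fn f (map (rename_trm \<rho>) ts)"

text \<open>The bound variable becomes a number above the images of all free variables of the body,
  so nothing is captured, whatever the map \<rho>. Inserting 0 keeps \<open>Max\<close> meaningful
  for a body without free variables.\<close>

fun rename :: "(nat \<Rightarrow> nat) \<Rightarrow> ('f, 'r) fm \<Rightarrow> ('f, 'r) fm" where
  "rename \<rho> (Eq s t) = Eq (rename_trm \<rho> s) (rename_trm \<rho> t)"
| "rename \<rho> (Rl r ts) = Rl r (map (rename_trm \<rho>) ts)"
| "rename \<rho> (Neg \<psi>) = Neg (rename \<rho> \<psi>)"
| "rename \<rho> (Conj \<psi> \<chi>) = Conj (rename \<rho> \<psi>) (rename \<rho> \<chi>)"
| "rename \<rho> (Ex n \<psi>) = (let m = Suc (Max (insert 0 (\<rho> ` fv \<psi>))) in Ex m (rename (\<rho>(n := m)) \<psi>))"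

lemma wf_rename_trm: "wf_trm L t \<Longrightarrow> wf_trm L (rename_trm \<rho> t)"
  by (induction t) auto

lemma fvt_rename_trm: "fvt (rename_trm \<rho> t) = \<rho> ` fvt t"
  by (induction t) auto

lemma tval_rename_trm: "tval N v (rename_trm \<rho> t) = tval N (\<lambda>k. v (\<rho> k)) t"
proof (induction t)
  case (Fn f ts)
  then show ?case by (simp add: comp_def cong: map_cong)
qed simp

lemma wf_rename: "wf_fm L \<psi> \<Longrightarrow> wf_fm L (rename \<rho> \<psi>)"
  by (induction \<psi> arbitrary: \<rho>) (auto simp: wf_rename_trm Let_def)

lemma fv_rename: "fv (rename \<rho> \<psi>) \<subseteq> \<rho> ` fv \<psi>"
proof (induction \<psi> arbitrary: \<rho>)
  case (Conj \<psi>1 \<psi>2)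
  then show ?case by (fastforce simp: image_Un)
next
  case (Ex n \<psi>)
  define m where "m = Suc (Max (insert 0 (\<rho> ` fv \<psi>)))"
  have "fv (rename (\<rho>(n := m)) \<psi>) \<subseteq> (\<rho>(n := m)) ` fv \<psi>" by (rule Ex.IH)
  also have "\<dots> - {m} \<subseteq> \<rho> ` (fv \<psi> - {n})" by auto
  finally show ?case by (auto simp: m_def[symmetric] Let_def)
qed (auto simp: fvt_rename_trm)

lemma sat_rename: "sat N v (rename \<rho> \<psi>) \<longleftrightarrow> sat N (\<lambda>k. v (\<rho> k)) \<psi>"
proof (induction \<psi> arbitrary: v \<rho>)
  case (Ex n \<psi>)
  define m where "m = Suc (Max (insert 0 (\<rho> ` fv \<psi>)))"
  \<comment> \<open>Freshness: updating \<open>v\<close> at \<open>m\<close> is seen by the body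
    only through \<open>n\<close>.\<close>
  have fresh: "\<rho> k \<noteq> m" if "k \<in> fv \<psi>" for k
  proof -
    have "\<rho> k \<le> Max (insert 0 (\<rho> ` fv \<psi>))"
      by (rule Max_ge) (auto simp: finite_fv that)
    then show ?thesis by (simp add: m_def)
  qed
  have "sat N (v(m := x)) (rename (\<rho>(n := m)) \<psi>) \<longleftrightarrow> sat N ((\<lambda>k. v (\<rho> k))(n := x)) \<psi>" for x
    unfolding Ex.IH by (rule sat_cong) (auto dest: fresh)
  then show ?case by (simp only: rename.simps sat.simps Let_def m_def[symmetric])
next
  case (Eq s t)
  show ?case by (simp add: tval_rename_trm)
next
  case (Rl r ts)
  show ?case by (simp add: tval_rename_trm comp_def)
next
  case (Neg \<psi>)
  show ?case by (simp only: rename.simps sat.simps Neg.IH)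
next
  case (Conj \<psi> \<chi>)
  show ?case by (simp only: rename.simps sat.simps Conj.IH)
qed

section \<open>Realizing tuples of a model in a saturated model\<close>

text \<open>A sentence true in \<open>N\<close> has its negation outside \<open>T\<close>, so
  completeness puts the sentence itself into \<open>T\<close>.\<close>

lemma elementarily_equivalent:
  assumes T: "complete_theory L T" and N: "is_model L T N" and C: "is_model L T C"
    and \<sigma>: "\<sigma> \<in> sentences L" and "v \<in> valuations N" "w \<in> valuations C" "sat N v \<sigma>"
  shows "sat C w \<sigma>"
proof -
  have "Neg \<sigma> \<notin> T" using assms by (auto simp: is_model_def)
  then have "\<sigma> \<in> T" using T \<sigma> by (auto simp: complete_theory_def)
  then show ?thesis using C assms by (auto simp: is_model_def)
qed

lemma exists_valuation: "is_model L T N \<Longrightarrow> \<exists>v. v \<in> valuations N"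
  by (auto simp: is_model_def is_struct_def valuations_def)

text \<open>A finite part of the type of \<open>v\<close> on \<open>zs\<close>, conjoined and
  existentially closed, is a sentence true in \<open>N\<close> and hence in \<open>C\<close>. So the
  type is finitely satisfiable in \<open>C\<close>, and saturation over the empty set of parameters
  realizes it.\<close>

lemma saturated_realizes_tuple:
  fixes C :: "('c, 'f, 'r) struct"
  assumes T: "complete_theory L T" and N: "is_model L T N" and C: "is_model L T C"
    and sat: "saturated \<kappa> L C" and \<kappa>: "natLeq <o \<kappa>"
    and v: "v \<in> valuations N"
  obtains b where "b \<in> valuations C"
    "\<And>\<psi>. \<psi> \<in> formulas L (set zs) \<Longrightarrow> sat C b \<psi> \<longleftrightarrow> sat N v \<psi>"
proof -
  obtain e where e: "e \<in> valuations C" using exists_valuation[OF C] by blast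
  define p where "p = {\<psi> \<in> formulas L (set zs). sat N v \<psi>} \<times> {e}"
  have "|{} :: 'c set| <o \<kappa>"
  proof -
    have "|{} :: 'c set| \<le>o natLeq"
      by (rule ordLess_imp_ordLeq) (simp add: finite_iff_ordLess_natLeq[symmetric])
    then show ?thesis using \<kappa> ordLeq_ordLess_trans by blast
  qed
  moreover have "partial_type C zs p"
    unfolding partial_type_def
  proof (intro allI impI)
    fix F assume F: "F \<subseteq> p" "finite F"
    then obtain \<psi>s where \<psi>s: "set \<psi>s = fst ` F" using finite_list[of "fst ` F"] by blast
    let ?\<sigma> = "Exs zs (conjs \<psi>s)"
    have fm: "\<psi> \<in> formulas L (set zs)" "sat N v \<psi>" if "\<psi> \<in> set \<psi>s" for \<psi>
      using that F by (auto simp: \<psi>s p_def)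
    have "?\<sigma> \<in> sentences L"
      using fm by (auto simp: formulas_def wf_Exs fv_Exs wf_conjs fv_conjs)
    moreover have "sat N v ?\<sigma>"
      using v N fm by (auto simp: sat_Exs sat_conjs is_model_def is_struct_def override_on_def
          intro!: bexI[of _ v])
    ultimately have "sat C e ?\<sigma>" using elementarily_equivalent[OF T N C] v e by blast
    then obtain b where b: "b \<in> valuations C" "\<forall>\<psi>\<in>set \<psi>s. sat C (override_on e b (set zs)) \<psi>"
      using e C by (auto simp: sat_Exs sat_conjs is_model_def is_struct_def)
    have "sat C (override_on e' b (set zs)) \<psi>" if "(\<psi>, e') \<in> F" for \<psi> e'
    proof -
      have "\<psi> \<in> set \<psi>s" using that \<psi>s by force
      moreover have "e' = e" using that F by (auto simp: p_def)
      ultimately show ?thesis using b by simp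
    qed
    then have "realizes C zs b F" by (auto simp: realizes_def)
    then show "realized C zs F" using b by (auto simp: realized_def)
  qed
  moreover have "\<forall>(\<psi>, e)\<in>p. wf_fm L \<psi> \<and> e \<in> valuations C \<and> e ` (fv \<psi> - set zs) \<subseteq> {}"
    using e by (auto simp: p_def formulas_def)
  ultimately have "realized C zs p"
    by (intro sat[unfolded saturated_def, THEN spec, THEN spec, THEN spec, THEN mp, of "{}" p zs]
        conjI empty_subsetI)
  then obtain b where b: "b \<in> valuations C"
      "\<And>\<psi>. \<psi> \<in> formulas L (set zs) \<Longrightarrow> sat N v \<psi> \<Longrightarrow> sat C (override_on e b (set zs)) \<psi>"
    by (fastforce simp: realized_def realizes_def p_def)
  \<comment> \<open>Realization gives one direction; applied to \<open>Neg \<psi>\<close> it gives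
    the other.\<close>
  have "sat C (override_on e b (set zs)) \<psi> \<longleftrightarrow> sat N v \<psi>" if "\<psi> \<in> formulas L (set zs)" for \<psi>
    using b(2)[of \<psi>] b(2)[of "Neg \<psi>"] that by (auto simp: formulas_def)
  moreover have "override_on e b (set zs) \<in> valuations C"
    using b e by (simp add: override_on_valuations)
  ultimately show thesis using that by blast
qed

lemma realized_family:
  "realized N xs {(\<phi>, a l) |l. P l} \<longleftrightarrow>
    (\<exists>b\<in>valuations N. \<forall>l. P l \<longrightarrow> sat N (override_on (a l) b (set xs)) \<phi>)"
  by (auto simp: realized_def realizes_def)

text \<open>Makes the joint solvability of \<open>s\<close> instances a single first-order formula:
  the solution variables \<open>xs\<close> are shared, while each \<rho> l sends \<open>ys\<close>
  to variables at which \<open>v\<close> takes the values of \<open>a l\<close>.\<close>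

lemma sat_Exs_conjs_rename:
  assumes disj: "set xs \<inter> set ys = {}" and \<phi>: "fv \<phi> \<subseteq> set xs \<union> set ys"
    and N: "univ N \<noteq> {}" and v: "v \<in> valuations N"
    and \<rho>_xs: "\<And>l z. z \<in> set xs \<Longrightarrow> \<rho> l z = z"
    and \<rho>_ys: "\<And>l z. z \<in> set ys \<Longrightarrow> \<rho> l z \<notin> set xs \<and> v (\<rho> l z) = a l z"
  shows "sat N v (Exs xs (conjs (map (\<lambda>l. rename (\<rho> l) \<phi>) [0..<s]))) \<longleftrightarrow>
    realized N xs {(\<phi>, a l) |l. l < s}"
proof -
  have "sat N (\<lambda>k. override_on v c (set xs) (\<rho> l k)) \<phi> \<longleftrightarrow>
      sat N (override_on (a l) c (set xs)) \<phi>" for c l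
  proof (rule sat_cong)
    fix k assume "k \<in> fv \<phi>"
    then have "k \<in> set xs \<or> k \<in> set ys" using \<phi> by blast
    then show "override_on v c (set xs) (\<rho> l k) = override_on (a l) c (set xs) k"
      using disj \<rho>_xs[of k l] \<rho>_ys[of k l] by (auto simp: override_on_def)
  qed
  then have "sat N v (Exs xs (conjs (map (\<lambda>l. rename (\<rho> l) \<phi>) [0..<s]))) \<longleftrightarrow>
      (\<exists>c\<in>valuations N. \<forall>l\<in>{0..<s}. sat N (override_on (a l) c (set xs)) \<phi>)"
    using v N by (simp add: sat_Exs sat_conjs sat_rename)
  then show ?thesis by (simp add: realized_family Ball_def)
qed

text \<open>The tuples are concatenated and realized in \<open>C\<close> together. Realizing them
  one by one would preserve their separate types, but not the joint solvability of the instances,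
  which depends on the type of the whole.\<close>

lemma transfer_family:
  assumes T: "complete_theory L T" and N: "is_model L T N" and C: "is_model L T C"
    and sat: "saturated \<kappa> L C" and \<kappa>: "natLeq <o \<kappa>"
    and disj: "set xs \<inter> set ys = {}" and \<phi>: "\<phi> \<in> formulas L (set xs \<union> set ys)"
    and a: "\<And>l. a l \<in> valuations N"
  obtains b where "\<And>l. b l \<in> valuations C"
    "\<And>l. l < s \<Longrightarrow> tp L C ys (b l) = tp L N ys (a l)"
    "realized C xs {(\<phi>, b l) |l. l < s} \<longleftrightarrow> realized N xs {(\<phi>, a l) |l. l < (s :: nat)}"
proof -
  define K where "K = Suc (Max (insert 0 (set xs)))"
  have K: "K + k \<notin> set xs" for k
  proof
    assume "K + k \<in> set xs"
    then have "K + k \<le> Max (insert 0 (set xs))" by (intro Max_ge) auto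
    then show False by (simp add: K_def)
  qed
  define \<rho> where "\<rho> l z = (if z \<in> set xs then z else K + prod_encode (l, z))" for l z
  have \<rho>_xs: "\<rho> l z = z" if "z \<in> set xs" for l z
    using that by (simp add: \<rho>_def)
  obtain zs where zs: "set zs = (\<Union>l<s. \<rho> l ` set ys)"
    using finite_list[of "\<Union>l<s. \<rho> l ` set ys"] by auto
  text \<open>The \<open>\<rho> l\<close> put disjoint copies of \<open>ys\<close>, for different \<open>l\<close>, beyond the variables \<open>xs\<close>, so that
    the single valuation \<open>v\<close> carries all the tuples \<open>a l\<close> at once.\<close>
  define v where "v k = (case prod_decode (k - K) of (l, z) \<Rightarrow> a l z)" for k
  have v: "v \<in> valuations N" using a by (simp add: valuations_def v_def Pi_iff split: prod.splits)
  have \<rho>_ys: "\<rho> l z \<notin> set xs" "v (\<rho> l z) = a l z" if "z \<in> set ys" for l z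
    using that disj K by (auto simp: v_def \<rho>_def)
  obtain b where b: "b \<in> valuations C"
      "\<And>\<psi>. \<psi> \<in> formulas L (set zs) \<Longrightarrow> sat C b \<psi> \<longleftrightarrow> sat N v \<psi>"
    using saturated_realizes_tuple[OF T N C sat \<kappa> v] by metis
  have univ: "univ C \<noteq> {}" "univ N \<noteq> {}" using C N by (auto simp: is_model_def is_struct_def)
  show thesis
  proof (rule that[of "\<lambda>l k. b (\<rho> l k)"])
    show "(\<lambda>k. b (\<rho> l k)) \<in> valuations C" for l using b by (auto simp: valuations_def)
    show "tp L C ys (\<lambda>k. b (\<rho> l k)) = tp L N ys (a l)" if "l < s" for l
    proof -
      have "sat C (\<lambda>k. b (\<rho> l k)) \<psi> \<longleftrightarrow> sat N (a l) \<psi>" if \<psi>: "\<psi> \<in> formulas L (set ys)" for \<psi>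
      proof -
        have "fv (rename (\<rho> l) \<psi>) \<subseteq> \<rho> l ` set ys"
          using \<psi> by (intro order_trans[OF fv_rename] image_mono) (simp add: formulas_def)
        then have "rename (\<rho> l) \<psi> \<in> formulas L (set zs)"
          using \<psi> \<open>l < s\<close> by (auto simp: formulas_def wf_rename zs)
        then have "sat C (\<lambda>k. b (\<rho> l k)) \<psi> \<longleftrightarrow> sat N (\<lambda>k. v (\<rho> l k)) \<psi>"
          using b by (simp add: sat_rename[symmetric])
        also have "\<dots> \<longleftrightarrow> sat N (a l) \<psi>"
          using \<psi> by (intro sat_cong) (auto simp: formulas_def intro!: \<rho>_ys)
        finally show ?thesis .
      qed
      then show ?thesis by (auto simp: tp_def)
    qed
    let ?\<chi> = "Exs xs (conjs (map (\<lambda>l. rename (\<rho> l) \<phi>) [0..<s]))"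
    have "fv (rename (\<rho> l) \<phi>) \<subseteq> set xs \<union> set zs" if "l < s" for l
    proof -
      have "fv (rename (\<rho> l) \<phi>) \<subseteq> \<rho> l ` (set xs \<union> set ys)"
        using \<phi> by (intro order_trans[OF fv_rename] image_mono) (simp add: formulas_def)
      also have "\<dots> \<subseteq> set xs \<union> set zs" using that by (auto simp: zs \<rho>_xs)
      finally show ?thesis .
    qed
    then have "(\<Union>l<s. fv (rename (\<rho> l) \<phi>)) \<subseteq> set xs \<union> set zs" by (intro UN_least) simp
    then have "fv ?\<chi> \<subseteq> set zs"
      unfolding fv_Exs fv_conjs set_map set_upt atLeast0LessThan by blast
    then have "?\<chi> \<in> formulas L (set zs)"
      using \<phi> by (auto simp: formulas_def wf_Exs wf_conjs wf_rename)
    then have "sat C b ?\<chi> \<longleftrightarrow> sat N v ?\<chi>" by (rule b(2))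
    moreover have "fv \<phi> \<subseteq> set xs \<union> set ys" using \<phi> by (simp add: formulas_def)
    ultimately show "realized C xs {(\<phi>, \<lambda>k. b (\<rho> l k)) |l. l < s} \<longleftrightarrow>
        realized N xs {(\<phi>, a l) |l. l < s}"
      using sat_Exs_conjs_rename[OF disj _ univ(1) b(1), of \<phi> \<rho> "\<lambda>l k. b (\<rho> l k)" s]
        sat_Exs_conjs_rename[OF disj _ univ(2) v, of \<phi> \<rho> a s] \<rho>_xs \<rho>_ys by blast
  qed
qed

section \<open>Ultrapowers\<close>

lemma ultrafilter_on_Collect_neg:
  assumes D: "ultrafilter_on I D"
  shows "{i\<in>I. \<not> P i} \<in> D \<longleftrightarrow> {i\<in>I. P i} \<notin> D"
proof
  assume 1: "{i\<in>I. \<not> P i} \<in> D"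
  show "{i\<in>I. P i} \<notin> D"
  proof
    assume "{i\<in>I. P i} \<in> D"
    from ultrafilter_on_Int[OF D 1 this] have "{} \<in> D"
      by (rule ultrafilter_on_mono[OF D]) auto
    then show False using D by (simp add: ultrafilter_on_def)
  qed
next
  assume "{i\<in>I. P i} \<notin> D"
  moreover have "I - {i\<in>I. P i} = {i\<in>I. \<not> P i}" by auto
  moreover have "{i\<in>I. P i} \<in> D \<or> I - {i\<in>I. P i} \<in> D"
    using D unfolding ultrafilter_on_def by (metis (lifting) mem_Collect_eq subsetI)
  ultimately show "{i\<in>I. \<not> P i} \<in> D" by simp
qed

lemma ultrafilter_on_Collect_conj:
  assumes D: "ultrafilter_on I D"
  shows "{i\<in>I. P i \<and> Q i} \<in> D \<longleftrightarrow> {i\<in>I. P i} \<in> D \<and> {i\<in>I. Q i} \<in> D"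
proof
  assume 1: "{i\<in>I. P i \<and> Q i} \<in> D"
  show "{i\<in>I. P i} \<in> D \<and> {i\<in>I. Q i} \<in> D"
    by (intro conjI; rule ultrafilter_on_mono[OF D 1]) auto
next
  assume "{i\<in>I. P i} \<in> D \<and> {i\<in>I. Q i} \<in> D"
  then have "{i\<in>I. P i} \<inter> {i\<in>I. Q i} \<in> D" using ultrafilter_on_Int[OF D] by blast
  then show "{i\<in>I. P i \<and> Q i} \<in> D" by (rule ultrafilter_on_mono[OF D]) auto
qed

lemma ultrafilter_on_Collect_ball:
  assumes D: "ultrafilter_on I D" and "finite S" and "\<And>x. x \<in> S \<Longrightarrow> {i\<in>I. P x i} \<in> D"
  shows "{i\<in>I. \<forall>x\<in>S. P x i} \<in> D"
  using assms(2,3)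
proof (induction S)
  case empty
  then show ?case using D by (simp add: ultrafilter_on_def)
next
  case (insert x S)
  then have "{i\<in>I. P x i \<and> (\<forall>x\<in>S. P x i)} \<in> D"
    by (subst ultrafilter_on_Collect_conj[OF D]) auto
  then show ?case by simp
qed

lemma ultrafilter_on_Collect_mono:
  assumes D: "ultrafilter_on I D" and P: "{i\<in>I. P i} \<in> D" and "\<And>i. i \<in> I \<Longrightarrow> P i \<Longrightarrow> Q i"
  shows "{i\<in>I. Q i} \<in> D"
  using assms(3) by (intro ultrafilter_on_mono[OF D P]) auto

lemma ultrafilter_on_Collect_cong:
  assumes D: "ultrafilter_on I D" and P: "{i\<in>I. P i} \<in> D"
    and "\<And>i. i \<in> I \<Longrightarrow> P i \<Longrightarrow> Q i \<longleftrightarrow> R i"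
  shows "{i\<in>I. Q i} \<in> D \<longleftrightarrow> {i\<in>I. R i} \<in> D"
proof
  assume "{i\<in>I. Q i} \<in> D"
  with P have "{i\<in>I. P i \<and> Q i} \<in> D" by (simp add: ultrafilter_on_Collect_conj[OF D])
  then show "{i\<in>I. R i} \<in> D" by (rule ultrafilter_on_Collect_mono[OF D]) (use assms(3) in auto)
next
  assume "{i\<in>I. R i} \<in> D"
  with P have "{i\<in>I. P i \<and> R i} \<in> D" by (simp add: ultrafilter_on_Collect_conj[OF D])
  then show "{i\<in>I. Q i} \<in> D" by (rule ultrafilter_on_Collect_mono[OF D]) (use assms(3) in auto)
qed

text \<open>The representative of a class is an arbitrary choice, so it recovers \<open>g\<close>
  only almost everywhere.\<close>

lemma urep_ucls:
  assumes D: "ultrafilter_on I D" and g: "g \<in> I \<rightarrow>\<^sub>E U"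
  shows "{i\<in>I. urep (ucls I D U g) i = g i} \<in> D"
  using urep_in[OF D ucls_in_upower[OF g]] ucls_eq_iff[OF D _ g] by metis

lemma urep_mem: "ultrafilter_on I D \<Longrightarrow> c \<in> upower I D U \<Longrightarrow> i \<in> I \<Longrightarrow> urep c i \<in> U"
  using urep_in(2) by (metis PiE_mem)

lemma tval_mem:
  assumes "is_struct L N" "v \<in> valuations N" "wf_trm L t"
  shows "tval N v t \<in> univ N"
  using assms(3)
proof (induction t)
  case (Fn f ts)
  then have "set (map (tval N v) ts) \<subseteq> univ N" by auto
  with Fn.prems assms(1) show ?case by (simp add: is_struct_def)
qed (use assms in \<open>auto simp: valuations_def\<close>)

section \<open>Los's theorem and the gluing of pointwise solutions\<close>

locale ultrapower_struct =
  fixes I :: "'i set" and D :: "'i set set" and L :: "('f, 'r) lang" and M :: "('m, 'f, 'r) struct"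
  assumes D: "ultrafilter_on I D" and M: "is_struct L M"
begin

abbreviation N where "N \<equiv> ultrapower I D M"

definition at :: "(nat \<Rightarrow> ('i \<Rightarrow> 'm) set) \<Rightarrow> 'i \<Rightarrow> nat \<Rightarrow> 'm" where
  "at v i = (\<lambda>k. urep (v k) i)"

lemma univ_N: "univ N = upower I D (univ M)"
  by (simp add: ultrapower_def)

lemma at_valuations: "v \<in> valuations N \<Longrightarrow> i \<in> I \<Longrightarrow> at v i \<in> valuations M"
  by (auto simp: valuations_def at_def univ_N Pi_iff intro: urep_mem[OF D])

lemma fint_mem_PiE:
  assumes "f \<in> fsyms L" "length cs = farity L f" "set cs \<subseteq> univ N"
  shows "(\<lambda>i\<in>I. fint M f (map (\<lambda>c. urep c i) cs)) \<in> I \<rightarrow>\<^sub>E univ M"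
proof -
  have "set (map (\<lambda>c. urep c i) cs) \<subseteq> univ M" if "i \<in> I" for i
    using assms(3) urep_mem[OF D _ that] by (auto simp: univ_N)
  then show ?thesis using M assms by (auto simp: is_struct_def)
qed

lemma is_struct_N: "is_struct L N"
proof -
  obtain u where "u \<in> univ M" using M by (auto simp: is_struct_def)
  then have "ucls I D (univ M) (\<lambda>i\<in>I. u) \<in> univ N" by (auto simp: univ_N intro: ucls_in_upower)
  then show ?thesis
    using ucls_in_upower[OF fint_mem_PiE] by (auto simp: is_struct_def ultrapower_def)
qed

text \<open>A list has finitely many arguments, so their exceptional sets together remain
  negligible. This serves function and relation symbols alike.\<close>

lemma Los_terms:
  assumes "\<And>t. t \<in> set ts \<Longrightarrow> {i\<in>I. urep (tval N v t) i = tval M (at v i) t} \<in> D"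
  shows "{i\<in>I. map (\<lambda>c. urep c i) (map (tval N v) ts) = map (tval M (at v i)) ts} \<in> D"
proof -
  have "{i\<in>I. \<forall>t\<in>set ts. urep (tval N v t) i = tval M (at v i) t} \<in> D"
    by (rule ultrafilter_on_Collect_ball[OF D]) (use assms in auto)
  then show ?thesis by (rule ultrafilter_on_Collect_mono[OF D]) auto
qed

lemma Los_term:
  assumes v: "v \<in> valuations N" and "wf_trm L t"
  shows "{i\<in>I. urep (tval N v t) i = tval M (at v i) t} \<in> D"
  using assms(2)
proof (induction t)
  case (Var n)
  then show ?case using D by (simp add: at_def ultrafilter_on_def)
next
  case (Fn f ts)
  let ?cs = "map (tval N v) ts"
  let ?g = "\<lambda>i\<in>I. fint M f (map (\<lambda>c. urep c i) ?cs)"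
  have "set ?cs \<subseteq> univ N" using tval_mem[OF is_struct_N v] Fn.prems by auto
  then have "?g \<in> I \<rightarrow>\<^sub>E univ M" using Fn.prems by (intro fint_mem_PiE) auto
  \<comment> \<open>Two negligible sets are discarded: where the representative of the value departs
    from \<open>?g\<close>, and where the induction hypothesis fails for some argument.\<close>
  from urep_ucls[OF D this]
  have 1: "{i\<in>I. urep (tval N v (Fn f ts)) i = ?g i} \<in> D"
    by (simp add: ultrapower_def)
  have 2: "{i\<in>I. map (\<lambda>c. urep c i) ?cs = map (tval M (at v i)) ts} \<in> D"
    by (rule Los_terms) (use v Fn in auto)
  from 1 2 have "{i\<in>I. urep (tval N v (Fn f ts)) i = ?g i \<and>
      map (\<lambda>c. urep c i) ?cs = map (tval M (at v i)) ts} \<in> D"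
    by (simp only: ultrafilter_on_Collect_conj[OF D])
  then show ?case
  proof (rule ultrafilter_on_Collect_mono[OF D], elim conjE)
    fix i assume i: "i \<in> I" and 1: "urep (tval N v (Fn f ts)) i = ?g i"
      and 2: "map (\<lambda>c. urep c i) ?cs = map (tval M (at v i)) ts"
    show "urep (tval N v (Fn f ts)) i = tval M (at v i) (Fn f ts)"
      unfolding 1 using i by (simp only: restrict_apply' tval.simps 2)
  qed
qed

lemma at_upd: "at (v(n := c)) i = (at v i)(n := urep c i)"
  by (auto simp: at_def)

theorem Los:
  assumes "v \<in> valuations N" and "wf_fm L \<psi>"
  shows "sat N v \<psi> \<longleftrightarrow> {i\<in>I. sat M (at v i) \<psi>} \<in> D"
  using assms
proof (induction \<psi> arbitrary: v)
  case (Eq s t)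
  then have st: "wf_trm L s" "wf_trm L t" by auto
  note mem = tval_mem[OF is_struct_N Eq.prems(1), unfolded univ_N]
  have "sat N v (Eq s t) \<longleftrightarrow> {i\<in>I. urep (tval N v s) i = urep (tval N v t) i} \<in> D"
    using ucls_eq_iff[OF D urep_in(2)[OF D mem[OF st(1)]] urep_in(2)[OF D mem[OF st(2)]]]
      urep_in(3)[OF D mem[OF st(1)]] urep_in(3)[OF D mem[OF st(2)]] by simp
  also have "\<dots> \<longleftrightarrow> {i\<in>I. sat M (at v i) (Eq s t)} \<in> D"
  proof (rule ultrafilter_on_Collect_cong[OF D])
    show "{i\<in>I. urep (tval N v s) i = tval M (at v i) s \<and>
        urep (tval N v t) i = tval M (at v i) t} \<in> D"
      using Los_term Eq.prems st by (simp add: ultrafilter_on_Collect_conj[OF D])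
  qed auto
  finally show ?case .
next
  case (Rl r ts)
  have "sat N v (Rl r ts) \<longleftrightarrow> {i\<in>I. rint M r (map (\<lambda>c. urep c i) (map (tval N v) ts))} \<in> D"
    by (simp add: ultrapower_def)
  also have "\<dots> \<longleftrightarrow> {i\<in>I. sat M (at v i) (Rl r ts)} \<in> D"
  proof (rule ultrafilter_on_Collect_cong[OF D])
    show "{i\<in>I. map (\<lambda>c. urep c i) (map (tval N v) ts) = map (tval M (at v i)) ts} \<in> D"
      using Rl.prems by (intro Los_terms Los_term) auto
  qed (simp only: sat.simps)
  finally show ?case .
next
  case (Neg \<psi>)
  then show ?case by (simp add: ultrafilter_on_Collect_neg[OF D])
next
  case (Conj \<psi> \<chi>)
  then show ?case by (simp add: ultrafilter_on_Collect_conj[OF D])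
next
  case (Ex n \<psi>)
  have IH: "sat N (v(n := c)) \<psi> \<longleftrightarrow> {i\<in>I. sat M ((at v i)(n := urep c i)) \<psi>} \<in> D"
    if "c \<in> univ N" for c
    using Ex that by (simp add: valuations_upd at_upd del: fun_upd_apply)
  show ?case
  proof
    assume "sat N v (Ex n \<psi>)"
    then obtain c where c: "c \<in> univ N" "{i\<in>I. sat M ((at v i)(n := urep c i)) \<psi>} \<in> D"
      using IH by auto
    from c(2) show "{i\<in>I. sat M (at v i) (Ex n \<psi>)} \<in> D"
      by (rule ultrafilter_on_Collect_mono[OF D])
        (use c(1) in \<open>auto simp: univ_N simp del: fun_upd_apply intro: urep_mem[OF D]\<close>)
  next
    assume 1: "{i\<in>I. sat M (at v i) (Ex n \<psi>)} \<in> D"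
    obtain u where u: "u \<in> univ M" using M by (auto simp: is_struct_def)
    \<comment> \<open>A witness is chosen wherever one exists and an arbitrary element of
      \<open>M\<close> elsewhere; the class of these choices is the witness in the
      ultrapower.\<close>
    have "\<exists>y\<in>univ M. sat M (at v i) (Ex n \<psi>) \<longrightarrow> sat M ((at v i)(n := y)) \<psi>" for i
      using u by auto
    then obtain w where w: "\<And>i. w i \<in> univ M"
      "\<And>i. sat M (at v i) (Ex n \<psi>) \<Longrightarrow> sat M ((at v i)(n := w i)) \<psi>"
      by metis
    define c where "c = ucls I D (univ M) (\<lambda>i\<in>I. w i)"
    have wE: "(\<lambda>i\<in>I. w i) \<in> I \<rightarrow>\<^sub>E univ M" using w by auto
    then have c: "c \<in> univ N" by (simp add: c_def univ_N ucls_in_upower)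
    have "{i\<in>I. sat M (at v i) (Ex n \<psi>) \<and> urep c i = (\<lambda>i\<in>I. w i) i} \<in> D"
      using 1 urep_ucls[OF D wE] by (simp add: ultrafilter_on_Collect_conj[OF D] c_def del: sat.simps)
    then have "{i\<in>I. sat M ((at v i)(n := urep c i)) \<psi>} \<in> D"
      by (rule ultrafilter_on_Collect_mono[OF D]) (use w(2) in \<open>simp del: fun_upd_apply sat.simps\<close>)
    then show "sat N v (Ex n \<psi>)" using IH[OF c] c by auto
  qed
qed

lemma is_model_N:
  assumes T: "T \<subseteq> sentences L" and "is_model L T M"
  shows "is_model L T N"
  unfolding is_model_def
proof (intro conjI ballI is_struct_N)
  fix \<sigma> v assume \<sigma>: "\<sigma> \<in> T" and v: "v \<in> valuations N"
  have "wf_fm L \<sigma>" using T \<sigma> by (auto simp: formulas_def)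
  moreover have "{i\<in>I. sat M (at v i) \<sigma>} = I"
    using assms(2) \<sigma> at_valuations[OF v] by (auto simp: is_model_def)
  ultimately show "sat N v \<sigma>" using Los[OF v] D by (simp add: ultrafilter_on_def)
qed

text \<open>Solutions chosen index by index are glued into a tuple of classes, to which Los's
  theorem applies. The large set of good indices may depend on \<alpha>.\<close>

lemma realized_pointwise:
  assumes \<phi>: "wf_fm L \<phi>" and a: "\<And>\<alpha>. \<alpha> \<in> A \<Longrightarrow> a \<alpha> \<in> valuations N"
    and b: "\<And>i. b i \<in> valuations M"
    and sat: "\<And>\<alpha>. \<alpha> \<in> A \<Longrightarrow> {i\<in>I. sat M (override_on (at (a \<alpha>) i) (b i) (set xs)) \<phi>} \<in> D"
  shows "realized N xs {(\<phi>, a \<alpha>) |\<alpha>. \<alpha> \<in> A}"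
  unfolding realized_family
proof (intro bexI allI impI)
  define c where "c k = ucls I D (univ M) (\<lambda>i\<in>I. b i k)" for k
  have bE: "(\<lambda>i\<in>I. b i k) \<in> I \<rightarrow>\<^sub>E univ M" for k using b by (auto simp: valuations_def)
  show c: "c \<in> valuations N" using ucls_in_upower[OF bE] by (simp add: c_def valuations_def univ_N)
  fix \<alpha> assume \<alpha>: "\<alpha> \<in> A"
  \<comment> \<open>Only the finitely many variables in \<open>xs\<close> matter, so one large set
    serves them all.\<close>
  have "{i\<in>I. \<forall>k\<in>set xs. urep (c k) i = (\<lambda>i\<in>I. b i k) i} \<in> D"
    using urep_ucls[OF D bE] by (intro ultrafilter_on_Collect_ball[OF D]) (auto simp: c_def)
  with sat[OF \<alpha>] have "{i\<in>I. sat M (override_on (at (a \<alpha>) i) (b i) (set xs)) \<phi> \<and>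
      (\<forall>k\<in>set xs. urep (c k) i = (\<lambda>i\<in>I. b i k) i)} \<in> D"
    by (simp only: ultrafilter_on_Collect_conj[OF D])
  then have "{i\<in>I. sat M (at (override_on (a \<alpha>) c (set xs)) i) \<phi>} \<in> D"
  proof (rule ultrafilter_on_Collect_mono[OF D], elim conjE)
    fix i assume i: "i \<in> I" "\<forall>k\<in>set xs. urep (c k) i = (\<lambda>i\<in>I. b i k) i"
      and s: "sat M (override_on (at (a \<alpha>) i) (b i) (set xs)) \<phi>"
    have "at (override_on (a \<alpha>) c (set xs)) i = override_on (at (a \<alpha>) i) (b i) (set xs)"
      using i by (auto simp: at_def override_on_def)
    with s show "sat M (at (override_on (a \<alpha>) c (set xs)) i) \<phi>" by simp
  qed
  then show "sat N (override_on (a \<alpha>) c (set xs)) \<phi>"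
    using Los[OF override_on_valuations[OF a[OF \<alpha>] c] \<phi>] by simp
qed

end

section \<open>Nonstandard integers below given ones\<close>

text \<open>Staying above \<open>k\<close> means avoiding finitely many constants, each of which is
  avoided almost everywhere.\<close>

lemma nonstandard_iff:
  assumes D: "ultrafilter_on I D"
  shows "nonstandard I D t \<longleftrightarrow> (\<forall>k. {i\<in>I. k < t i} \<in> D)"
proof
  assume t: "nonstandard I D t"
  show "\<forall>k. {i\<in>I. k < t i} \<in> D"
  proof
    fix k
    have "{i\<in>I. \<forall>j\<in>{..k}. t i \<noteq> j} \<in> D"
      using t by (intro ultrafilter_on_Collect_ball[OF D])
        (auto simp: ultrafilter_on_Collect_neg[OF D] nonstandard_def)
    then show "{i\<in>I. k < t i} \<in> D" by (rule ultrafilter_on_Collect_mono[OF D]) force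
  qed
next
  assume *: "\<forall>k. {i\<in>I. k < t i} \<in> D"
  have "{i\<in>I. \<not> t i = k} \<in> D" for k
    by (rule ultrafilter_on_Collect_mono[OF D *[rule_format, of k]]) simp
  then show "nonstandard I D t" by (simp add: nonstandard_def ultrafilter_on_Collect_neg[OF D])
qed

text \<open>The integer counts the members of the regularizing family that contain \<open>i\<close>:
  any \<open>k + 1\<close> of them meet in a large set, on which the count exceeds
  \<open>k\<close>.\<close>

lemma regular_imp_nonstandard:
  fixes I :: "'i set" and lam :: "'l rel"
  assumes D: "ultrafilter_on I D" and "regular I D lam" and inf: "infinite (Field lam)"
  obtains t where "nonstandard I D t"
proof -
  obtain X :: "'l \<Rightarrow> 'i set" where X: "\<And>\<alpha>. \<alpha> \<in> Field lam \<Longrightarrow> X \<alpha> \<in> D"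
    and fin: "\<And>i. i \<in> I \<Longrightarrow> finite {\<alpha>\<in>Field lam. i \<in> X \<alpha>}"
    using assms(2) unfolding regular_def by blast
  define t where "t i = card {\<alpha>\<in>Field lam. i \<in> X \<alpha>}" for i
  have "{i\<in>I. k < t i} \<in> D" for k
  proof -
    obtain S where S: "S \<subseteq> Field lam" "finite S" "card S = Suc k"
      using inf infinite_arbitrarily_large by blast
    have "I \<in> D" using D by (simp add: ultrafilter_on_def)
    have XD: "{i\<in>I. i \<in> X \<alpha>} \<in> D" if "\<alpha> \<in> S" for \<alpha>
    proof -
      have "X \<alpha> \<in> D" using X S that by blast
      from ultrafilter_on_Int[OF D \<open>I \<in> D\<close> this] show ?thesis by (simp add: Int_def)
    qed
    have "{i\<in>I. \<forall>\<alpha>\<in>S. i \<in> X \<alpha>} \<in> D"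
      by (rule ultrafilter_on_Collect_ball[OF D S(2)]) (rule XD)
    then show ?thesis
    proof (rule ultrafilter_on_Collect_mono[OF D])
      fix i assume i: "i \<in> I" "\<forall>\<alpha>\<in>S. i \<in> X \<alpha>"
      have "card S \<le> t i" unfolding t_def using i S fin by (intro card_mono) auto
      then show "k < t i" using S by simp
    qed
  qed
  then show thesis by (intro that[of t]) (simp add: nonstandard_iff[OF D])
qed

text \<open>An internal set containing the standard integers but no \<open>t \<alpha>\<close> has a least element outside it,
  and the predecessor of that element lies below every \<open>t \<alpha>\<close>.\<close>

lemma good_for_random_graph_coinitiality:
  fixes lam :: "'l rel"
  assumes lam: "Card_order lam" "cinfinite lam" and D: "ultrafilter_on I D"
    and good: "good_for_random_graph TYPE(nat) I D lam"
    and t: "\<And>\<alpha>. \<alpha> \<in> Field lam \<Longrightarrow> nonstandard I D (t \<alpha>)"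
  obtains s where "nonstandard I D s" "\<And>\<alpha>. \<alpha> \<in> Field lam \<Longrightarrow> {i\<in>I. s i < t \<alpha> i} \<in> D"
proof -
  define cl where "cl g = ucls I D (UNIV :: nat set) (restrict g I)" for g
  have E: "restrict g I \<in> I \<rightarrow>\<^sub>E (UNIV :: nat set)" for g by auto
  have cl_eq: "cl g = cl h \<longleftrightarrow> {i\<in>I. g i = h i} \<in> D" for g h
    unfolding cl_def ucls_eq_iff[OF D E E] by (simp cong: conj_cong)
  have cl_int: "cl g \<in> internal I D UNIV P \<longleftrightarrow> {i\<in>I. g i \<in> P i} \<in> D" for g P
    unfolding cl_def ucls_internal_iff[OF D E] by (simp cong: conj_cong)
  \<comment> \<open>\<open>A\<close> consists of the standard integers; it is disjoint from
    \<open>B\<close> exactly because every \<open>t \<alpha>\<close> is nonstandard.\<close>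
  define A where "A = range (\<lambda>k. cl (\<lambda>_. k))"
  define B where "B = (\<lambda>\<alpha>. cl (t \<alpha>)) ` Field lam"
  have "|A| \<le>o natLeq"
    unfolding A_def using card_of_image[of _ "UNIV :: nat set"] card_of_nat
    by (meson ordLeq_ordIso_trans)
  moreover have "natLeq \<le>o lam"
    using lam by (intro natLeq_ordLeq_cinfinite) simp
  ultimately have "|A| \<le>o lam" by (rule ordLeq_transitive)
  moreover have "|B| \<le>o lam"
    unfolding B_def using card_of_image card_of_Field_ordIso[OF lam(1)] ordLeq_ordIso_trans by blast
  ultimately have "|A| +c |B| \<le>o lam"
    using lam by (intro csum_cinfinite_bound) (auto simp: card_of_Card_order)
  moreover have "A \<inter> B = {}"
    using t by (auto simp: A_def B_def cl_eq nonstandard_def eq_commute)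
  moreover have "A \<subseteq> upower I D UNIV" "B \<subseteq> upower I D UNIV"
    using ucls_in_upower[OF E] by (auto simp: A_def B_def cl_def)
  moreover note good[unfolded good_for_random_graph_def, THEN spec, THEN mp, OF infinite_UNIV_nat,
    THEN spec, THEN spec, THEN mp, of A B]
  ultimately obtain P where P: "A \<subseteq> internal I D UNIV P" "B \<inter> internal I D UNIV P = {}"
    by blast
  have PA: "{i\<in>I. k \<in> P i} \<in> D" for k
    using P(1) cl_int[of "\<lambda>_. k" P] by (auto simp: A_def)
  have PB: "{i\<in>I. t \<alpha> i \<notin> P i} \<in> D" if "\<alpha> \<in> Field lam" for \<alpha>
    using P(2) cl_int[of "t \<alpha>" P] that ultrafilter_on_Collect_neg[OF D] by (auto simp: B_def)
  \<comment> \<open>For each \<alpha>, almost every \<open>P i\<close> omits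
    \<open>t \<alpha> i\<close>, so the least element exists there; elsewhere its value is
    irrelevant.\<close>
  define u where "u i = (LEAST k. k \<notin> P i)" for i
  have u: "{i\<in>I. k < u i \<and> u i \<le> t \<alpha> i} \<in> D" if "\<alpha> \<in> Field lam" for k \<alpha>
  proof -
    have "{i\<in>I. \<forall>j\<in>{..k}. j \<in> P i} \<in> D"
      by (rule ultrafilter_on_Collect_ball[OF D]) (auto intro: PA)
    then have "{i\<in>I. (\<forall>j\<in>{..k}. j \<in> P i) \<and> t \<alpha> i \<notin> P i} \<in> D"
      using PB[OF that] by (simp only: ultrafilter_on_Collect_conj[OF D])
    then show ?thesis
    proof (rule ultrafilter_on_Collect_mono[OF D])
      fix i assume i: "(\<forall>j\<in>{..k}. j \<in> P i) \<and> t \<alpha> i \<notin> P i"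
      then have "u i \<notin> P i" unfolding u_def by (elim conjE) (rule LeastI)
      then have "k < u i" using i by (meson atMost_iff not_le)
      moreover have "u i \<le> t \<alpha> i" unfolding u_def using i by (elim conjE) (rule Least_le)
      ultimately show "k < u i \<and> u i \<le> t \<alpha> i" ..
    qed
  qed
  show thesis
  proof (rule that[of "\<lambda>i. u i - 1"])
    \<comment> \<open>The lower bound on \<open>u\<close> was obtained together with an upper bound
      by some \<open>t \<alpha>\<close>, so an index is needed.\<close>
    obtain \<alpha>0 where \<alpha>0: "\<alpha>0 \<in> Field lam" using lam by (auto simp: cinfinite_def dest: infinite_imp_nonempty)
    have "{i\<in>I. k < u i - 1} \<in> D" for k
      by (rule ultrafilter_on_Collect_mono[OF D u[OF \<alpha>0, of "Suc k"]]) auto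
    then show "nonstandard I D (\<lambda>i. u i - 1)" by (simp add: nonstandard_iff[OF D])
    \<comment> \<open>As \<open>u i\<close> may equal \<open>t \<alpha> i\<close>, strictness comes
      from the predecessor, which is smaller because \<open>u i\<close> is positive almost
      everywhere.\<close>
    show "{i\<in>I. u i - 1 < t \<alpha> i} \<in> D" if "\<alpha> \<in> Field lam" for \<alpha>
      by (rule ultrafilter_on_Collect_mono[OF D u[OF that, of 0]]) auto
  qed
qed

section \<open>Saturation of ultrapowers\<close>

text \<open>\<open>C\<close> realizes the type of \<open>a\<close>, so this type is among those
  computed in \<open>C\<close>. Thus the clauses of the pseudo-nfcp on \<open>f\<close> apply to
  types of tuples from \<open>M\<close> and from the ultrapower.\<close>

lemma tp_in_phi_types:
  assumes T: "complete_theory L T" and N: "is_model L T N" and C: "is_model L T C"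
    and sat: "saturated \<kappa> L C" and \<kappa>: "natLeq <o \<kappa>"
    and \<phi>: "\<phi> \<in> formulas L (set xs \<union> set ys)"
    and a: "a \<in> valuations N" and ex: "sat N a (Exs xs \<phi>)"
  shows "tp L N ys a \<in> phi_types L C \<phi> xs ys"
proof -
  obtain b where b: "b \<in> valuations C"
      "\<And>\<psi>. \<psi> \<in> formulas L (set ys) \<Longrightarrow> sat C b \<psi> \<longleftrightarrow> sat N a \<psi>"
    using saturated_realizes_tuple[OF T N C sat \<kappa> a] by metis
  have "sat C (override_on e b (set ys)) \<psi>" if "\<psi> \<in> tp L N ys a" for e \<psi>
  proof -
    have "sat C (override_on e b (set ys)) \<psi> \<longleftrightarrow> sat C b \<psi>"
      using that by (intro sat_cong) (auto simp: tp_def formulas_def override_on_def)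
    then show ?thesis using that b by (auto simp: tp_def)
  qed
  then have "realizes C ys b F" if "F \<subseteq> tp L N ys a \<times> valuations C" for F
    using that unfolding realizes_def by blast
  then have "partial_type C ys (tp L N ys a \<times> valuations C)"
    unfolding partial_type_def realized_def using b(1) by blast
  moreover have "Exs xs \<phi> \<in> tp L N ys a"
    using \<phi> ex by (auto simp: tp_def formulas_def wf_Exs fv_Exs)
  moreover have "tp L N ys a \<subseteq> formulas L (set ys)"
    "\<forall>\<psi>\<in>formulas L (set ys). \<psi> \<in> tp L N ys a \<or> Neg \<psi> \<in> tp L N ys a"
    by (auto simp: tp_def formulas_def)
  ultimately show ?thesis by (simp add: phi_types_def complete_types_def)
qed

lemma realized_subset: "realized N xs p \<Longrightarrow> q \<subseteq> p \<Longrightarrow> realized N xs q"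
  unfolding realized_def realizes_def
  by (elim bexE, rule bexI, rule ballI, drule (1) subsetD, erule (1) bspec)

lemma finite_partial_type_iff: "finite p \<Longrightarrow> partial_type N xs p \<longleftrightarrow> realized N xs p"
  using realized_subset[of N xs p] by (auto simp: partial_type_def)

text \<open>Clause (2) speaks of families of length exactly \<open>s\<close>; a smaller set is
  padded by repeating its first element.\<close>

lemma finite_enumeration:
  assumes "finite S" "S \<noteq> {}" "card S \<le> s"
  obtains h :: "nat \<Rightarrow> 'a" where "h ` {..<s} = S"
proof -
  obtain e where e: "bij_betw e {0..<card S} S" using assms(1) ex_bij_betw_nat_finite by blast
  have "0 < card S" using assms by (simp add: card_gt_0_iff)
  define h where "h l = e (if l < card S then l else 0)" for l
  have "h ` {..<s} = e ` {0..<card S}"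
    using assms(3) \<open>0 < card S\<close> by (force simp: h_def)
  then show thesis using e by (intro that[of h]) (simp add: bij_betw_def)
qed

text \<open>Clause (2) with \<open>s\<close> and \<open>n\<close> fixed; isolating it lets
  \<open>n\<close> be chosen as a function of \<open>s\<close>.\<close>

definition consistency_determined ::
  "('f, 'r) lang \<Rightarrow> ('a, 'f, 'r) struct \<Rightarrow> ('f, 'r) fm \<Rightarrow> nat list \<Rightarrow> nat list \<Rightarrow>
    (('f, 'r) fm set \<Rightarrow> nat \<Rightarrow> nat) \<Rightarrow> nat \<Rightarrow> nat \<Rightarrow> bool" where
  "consistency_determined L C \<phi> xs ys f s n \<longleftrightarrow> (\<forall>a b :: nat \<Rightarrow> nat \<Rightarrow> 'a.
     (\<forall>l<s. a l \<in> valuations C \<and> b l \<in> valuations C \<and>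
        tp L C ys (a l) \<in> phi_types L C \<phi> xs ys \<and>
        tp L C ys (b l) \<in> phi_types L C \<phi> xs ys \<and>
        (\<forall>j<n. f (tp L C ys (a l)) j = f (tp L C ys (b l)) j)) \<and>
     partial_type C xs {(\<phi>, a l) |l. l < s} \<longrightarrow>
     partial_type C xs {(\<phi>, b l) |l. l < s})"

text \<open>Clause (2) compares tuples of \<open>C\<close>, whereas here one family lies in
  \<open>N\<close> and the other in \<open>M\<close>. Both are copied into \<open>C\<close> with
  their types and their joint solvability, and the conclusion is pulled back to
  \<open>M\<close>.\<close>

lemma pseudo_nfcp_models:
  fixes C :: "('c, 'f, 'r) struct"
  assumes T: "complete_theory L T" and N: "is_model L T N" and M: "is_model L T M"
    and C: "is_model L T C" and sat: "saturated \<kappa> L C" and \<kappa>: "natLeq <o \<kappa>"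
    and disj: "set xs \<inter> set ys = {}" and \<phi>: "\<phi> \<in> formulas L (set xs \<union> set ys)"
    and nfcp: "consistency_determined L C \<phi> xs ys f s n"
    and a: "\<And>l. a l \<in> valuations N" and c: "\<And>l. c l \<in> valuations M"
    and a_tp: "\<And>l. l < s \<Longrightarrow> tp L N ys (a l) \<in> phi_types L C \<phi> xs ys"
    and c_tp: "\<And>l. l < s \<Longrightarrow> tp L M ys (c l) \<in> phi_types L C \<phi> xs ys"
    and eq: "\<And>l j. l < s \<Longrightarrow> j < n \<Longrightarrow> f (tp L N ys (a l)) j = f (tp L M ys (c l)) j"
    and real: "realized N xs {(\<phi>, a l) |l. l < (s :: nat)}"
  shows "realized M xs {(\<phi>, c l) |l. l < s}"
proof -
  note fin = finite_partial_type_iff[OF finite_image_set[of "\<lambda>l. l < s"]]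
  obtain a' where a': "\<And>l. a' l \<in> valuations C"
    "\<And>l. l < s \<Longrightarrow> tp L C ys (a' l) = tp L N ys (a l)"
    "realized C xs {(\<phi>, a' l) |l. l < s} \<longleftrightarrow> realized N xs {(\<phi>, a l) |l. l < s}"
    using transfer_family[where s = s and a = a, OF T N C sat \<kappa> disj \<phi> a] by blast
  obtain c' where c': "\<And>l. c' l \<in> valuations C"
    "\<And>l. l < s \<Longrightarrow> tp L C ys (c' l) = tp L M ys (c l)"
    "realized C xs {(\<phi>, c' l) |l. l < s} \<longleftrightarrow> realized M xs {(\<phi>, c l) |l. l < s}"
    using transfer_family[where s = s and a = c, OF T M C sat \<kappa> disj \<phi> c] by blast
  have "partial_type C xs {(\<phi>, a' l) |l. l < s}" using real a'(3) by (simp add: fin)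
  then have "partial_type C xs {(\<phi>, c' l) |l. l < s}"
    using nfcp[unfolded consistency_determined_def, THEN spec, THEN spec, THEN mp, of a' c']
      a' c' a_tp c_tp eq by simp
  then show ?thesis using c'(3) by (simp add: fin)
qed

theorem theorem4p3:
  fixes I :: "'i set" and D :: "'i set set" and lam :: "'l rel"
    and L :: "('f, 'r) lang" and T :: "('f, 'r) fm set"
    and \<phi> :: "('f, 'r) fm" and xs ys :: "nat list"
    and \<kappa> :: "'k rel" and C :: "('c, 'f, 'r) struct"
    and M :: "('m, 'f, 'r) struct"
  assumes "Card_order lam" and "cinfinite lam" and "|I| =o lam"
    and "ultrafilter_on I D" and "regular I D lam"
    and "flexible I D lam" and "good_for_random_graph TYPE(nat) I D lam"
    and "complete_theory L T" and "countable_lang L"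
    and "monster_model \<kappa> L T C"
    and "distinct xs" and "distinct ys" and "set xs \<inter> set ys = {}"
    and "\<phi> \<in> formulas L (set xs \<union> set ys)"
    and "pseudo_nfcp L C \<phi> xs ys"
    and "is_model L T M"
  shows "saturated_for_positive_types lam (ultrapower I D M) \<phi> xs"
  unfolding saturated_for_positive_types_def
proof (intro allI impI, elim conjE)
  note D = \<open>ultrafilter_on I D\<close> and T = \<open>complete_theory L T\<close> and MT = \<open>is_model L T M\<close>
    and disj = \<open>set xs \<inter> set ys = {}\<close> and \<phi> = \<open>\<phi> \<in> formulas L (set xs \<union> set ys)\<close>
  have C: "is_model L T C" "saturated \<kappa> L C" "natLeq <o \<kappa>"
    using \<open>monster_model \<kappa> L T C\<close> by (auto simp: monster_model_def)
  interpret ultrapower_struct I D L M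
    using D MT by unfold_locales (auto simp: is_model_def)
  have N: "is_model L T N" using is_model_N[OF _ MT] T by (auto simp: complete_theory_def)
  let ?P = "phi_types L C \<phi> xs ys"
  fix a
  assume "\<forall>\<alpha>\<in>Field lam. a \<alpha> \<in> valuations N"
    and pt: "partial_type N xs {(\<phi>, a \<alpha>) |\<alpha>. \<alpha> \<in> Field lam}"
  then have a: "a \<alpha> \<in> valuations N" if "\<alpha> \<in> Field lam" for \<alpha> using that by blast
  have "\<exists>f :: ('f, 'r) fm set \<Rightarrow> nat \<Rightarrow> nat.
      (\<forall>m. \<forall>p\<in>?P. \<forall>r. f p m = r \<longrightarrow> (\<exists>\<psi>\<in>p. \<forall>q\<in>?P. \<psi> \<in> q \<longrightarrow> f q m = r)) \<and>
      (\<forall>s\<ge>1. \<exists>n. consistency_determined L C \<phi> xs ys f s n)"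
    using \<open>pseudo_nfcp L C \<phi> xs ys\<close> unfolding pseudo_nfcp_def consistency_determined_def
    by (rule conjunct2)
  then obtain f :: "('f, 'r) fm set \<Rightarrow> nat \<Rightarrow> nat" and n
    where cont: "\<forall>m. \<forall>p\<in>?P. \<forall>r. f p m = r \<longrightarrow> (\<exists>\<psi>\<in>p. \<forall>q\<in>?P. \<psi> \<in> q \<longrightarrow> f q m = r)"
    and n: "\<And>s. s \<ge> 1 \<Longrightarrow> consistency_determined L C \<phi> xs ys f s (n s)"
    by metis
  have real: "realized N xs {(\<phi>, a (h l)) |l. l < s}"
    if "\<And>l. l < s \<Longrightarrow> h l \<in> Field lam" for s :: nat and h
  proof -
    have "{(\<phi>, a (h l)) |l. l < s} \<subseteq> {(\<phi>, a \<alpha>) |\<alpha>. \<alpha> \<in> Field lam}" using that by blast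
    moreover have "finite {(\<phi>, a (h l)) |l. l < s}" by simp
    ultimately show ?thesis using pt unfolding partial_type_def by blast
  qed
  \<comment> \<open>Solvability of each single instance puts the type of every parameter among those
    for which the clauses on \<open>f\<close> hold.\<close>
  have ex: "sat N (a \<alpha>) (Exs xs \<phi>)" if "\<alpha> \<in> Field lam" for \<alpha>
  proof -
    have "\<exists>b\<in>valuations N. \<forall>l<1::nat. sat N (override_on (a \<alpha>) b (set xs)) \<phi>"
      using real[of 1 "\<lambda>_. \<alpha>"] that unfolding realized_family by blast
    then show ?thesis by (simp add: sat_Exs[OF a[OF that]])
  qed
  have tpN: "tp L N ys (a \<alpha>) \<in> ?P" if "\<alpha> \<in> Field lam" for \<alpha>
    by (rule tp_in_phi_types[OF T N C \<phi> a[OF that] ex[OF that]])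
  \<comment> \<open>At some indices the instance may have no solution in \<open>M\<close>. The
    clauses say nothing about \<open>f\<close> there, so such indices are excluded
    explicitly.\<close>
  define ok where "ok \<alpha> i \<longleftrightarrow> tp L M ys (at (a \<alpha>) i) \<in> ?P" for \<alpha> i
  define agree where "agree \<alpha> s i \<longleftrightarrow>
    (\<forall>j<n s. f (tp L N ys (a \<alpha>)) j = f (tp L M ys (at (a \<alpha>) i)) j)" for \<alpha> s i
  have ok: "{i\<in>I. ok \<alpha> i} \<in> D" if \<alpha>: "\<alpha> \<in> Field lam" for \<alpha>
  proof -
    have "wf_fm L (Exs xs \<phi>)" using \<phi> by (simp add: wf_Exs formulas_def)
    from ex[OF \<alpha>, unfolded Los[OF a[OF \<alpha>] this]] show ?thesis
      by (rule ultrafilter_on_Collect_mono[OF D])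
        (auto simp: ok_def intro: tp_in_phi_types[OF T MT C \<phi> at_valuations[OF a[OF \<alpha>]]])
  qed
  have agree: "{i\<in>I. agree \<alpha> s i} \<in> D" if \<alpha>: "\<alpha> \<in> Field lam" for \<alpha> s
  proof -
    have "{i\<in>I. f (tp L N ys (a \<alpha>)) j = f (tp L M ys (at (a \<alpha>) i)) j} \<in> D" for j
    proof -
      \<comment> \<open>Continuity yields one formula deciding the value at \<open>j\<close>; by
        Los's theorem almost all coordinates satisfy it.\<close>
      obtain \<psi> where \<psi>: "\<psi> \<in> tp L N ys (a \<alpha>)"
        "\<And>q. q \<in> ?P \<Longrightarrow> \<psi> \<in> q \<Longrightarrow> f q j = f (tp L N ys (a \<alpha>)) j"
        using cont tpN[OF \<alpha>] by metis
      have fm: "\<psi> \<in> formulas L (set ys)" and "sat N (a \<alpha>) \<psi>" using \<psi>(1) by (auto simp: tp_def)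
      then have "{i\<in>I. sat M (at (a \<alpha>) i) \<psi>} \<in> D"
        using Los[OF a[OF \<alpha>], of \<psi>] by (simp add: formulas_def)
      then have "{i\<in>I. sat M (at (a \<alpha>) i) \<psi> \<and> ok \<alpha> i} \<in> D"
        using ok[OF \<alpha>] by (simp add: ultrafilter_on_Collect_conj[OF D])
      then show ?thesis
        by (rule ultrafilter_on_Collect_mono[OF D]) (use fm \<psi>(2) in \<open>simp add: ok_def tp_def\<close>)
    qed
    then have "{i\<in>I. \<forall>j\<in>{..<n s}. f (tp L N ys (a \<alpha>)) j = f (tp L M ys (at (a \<alpha>) i)) j} \<in> D"
      by (intro ultrafilter_on_Collect_ball[OF D]) auto
    then show ?thesis by (simp add: agree_def Ball_def)
  qed
  have inf: "infinite (Field lam)" using \<open>cinfinite lam\<close> by (simp add: cinfinite_def)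
  obtain b where b: "nonstandard I D b"
    using regular_imp_nonstandard[OF D \<open>regular I D lam\<close> inf] by metis
  text \<open>The nonstandard bound \<open>b\<close> only serves to make the minimum exist when there is agreement
    at every \<open>s\<close>.\<close>
  define t where "t \<alpha> i = (LEAST s. s = b i \<or> \<not> agree \<alpha> s i)" for \<alpha> i
  have agree_t: "agree \<alpha> s i" if "s < t \<alpha> i" for \<alpha> s i
    using not_less_Least[OF that[unfolded t_def]] by blast
  have t: "nonstandard I D (t \<alpha>)" if \<alpha>: "\<alpha> \<in> Field lam" for \<alpha>
    unfolding nonstandard_iff[OF D]
  proof
    fix k
    \<comment> \<open>Since \<open>n\<close> need not be monotone, agreement at \<open>k\<close>
      does not give agreement at smaller \<open>s\<close>; all \<open>s\<close> up to
      \<open>k\<close> are required.\<close>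
    have "{i\<in>I. \<forall>s\<in>{..k}. agree \<alpha> s i} \<in> D"
      by (intro ultrafilter_on_Collect_ball[OF D] agree \<alpha>) simp
    then have "{i\<in>I. (\<forall>s\<in>{..k}. agree \<alpha> s i) \<and> k < b i} \<in> D"
      using b by (simp add: ultrafilter_on_Collect_conj[OF D] nonstandard_iff[OF D])
    then show "{i\<in>I. k < t \<alpha> i} \<in> D"
    proof (rule ultrafilter_on_Collect_mono[OF D], elim conjE)
      fix i assume i: "\<forall>s\<in>{..k}. agree \<alpha> s i" "k < b i"
      have "t \<alpha> i = b i \<or> \<not> agree \<alpha> (t \<alpha> i) i" unfolding t_def by (rule LeastI) blast
      with i show "k < t \<alpha> i" by (metis atMost_iff not_le)
    qed
  qed
  from good_for_random_graph_coinitiality[where t = t, OF \<open>Card_order lam\<close> \<open>cinfinite lam\<close> D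
    \<open>good_for_random_graph TYPE(nat) I D lam\<close> t]
  obtain s where s: "nonstandard I D s" "\<And>\<alpha>. \<alpha> \<in> Field lam \<Longrightarrow> {i\<in>I. s i < t \<alpha> i} \<in> D"
    by blast
  obtain X :: "'l \<Rightarrow> 'i set" where X: "\<And>\<alpha>. \<alpha> \<in> Field lam \<Longrightarrow> X \<alpha> \<in> D"
    and X_fin: "\<And>i. i \<in> I \<Longrightarrow> finite {\<alpha>\<in>Field lam. i \<in> X \<alpha>}"
    and X_card: "\<And>i. i \<in> I \<Longrightarrow> card {\<alpha>\<in>Field lam. i \<in> X \<alpha>} \<le> s i"
    using \<open>flexible I D lam\<close>[unfolded flexible_def, THEN spec, THEN mp, OF s(1)] by blast
  \<comment> \<open>Flexibility assigns at most \<open>s i\<close> parameters to the index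
    \<open>i\<close>; those behaving badly there are dropped.\<close>
  define S where "S i = {\<alpha>\<in>Field lam. i \<in> X \<alpha> \<and> s i < t \<alpha> i \<and> ok \<alpha> i}" for i
  have "\<exists>c\<in>valuations M. \<forall>\<alpha>\<in>S i. i \<in> I \<longrightarrow> sat M (override_on (at (a \<alpha>) i) c (set xs)) \<phi>" for i
  proof (cases "i \<in> I \<and> S i \<noteq> {}")
    case False
    then show ?thesis using exists_valuation[OF MT] by blast
  next
    case True
    have sub: "S i \<subseteq> {\<alpha>\<in>Field lam. i \<in> X \<alpha>}" by (auto simp: S_def)
    have "finite (S i)" "card (S i) \<le> s i"
      using finite_subset[OF sub X_fin] card_mono[OF X_fin sub] X_card True
      by (auto intro: order_trans)
    then obtain h where h: "h ` {..<s i} = S i" using finite_enumeration True by metis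
    \<comment> \<open>Clause (2) starts at one instance.\<close>
    have "s i \<ge> 1" using h True by (cases "s i") auto
    have hS: "h l \<in> S i" if "l < s i" for l using h that by blast
    \<comment> \<open>Beyond \<open>s i\<close> the enumeration is padded, because the comparison
      lemma asks for valuations at every natural number.\<close>
    define h' where "h' l = (if l < s i then h l else h 0)" for l
    have h': "h' l \<in> S i" for l using hS \<open>s i \<ge> 1\<close> by (simp add: h'_def)
    then have h'F: "h' l \<in> Field lam" for l by (auto simp: S_def)
    \<comment> \<open>At a fixed index \<open>s i\<close> is an ordinary natural number, so finite
      satisfiability in the ultrapower covers the family being compared.\<close>
    have "realized M xs {(\<phi>, at (a (h' l)) i) |l. l < s i}"
    proof (rule pseudo_nfcp_models[where n = "n (s i)" and f = f and a = "\<lambda>l. a (h' l)",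
          OF T N MT C disj \<phi> n[OF \<open>s i \<ge> 1\<close>]])
      show "at (a (h' l)) i \<in> valuations M" for l using at_valuations a h'F True by blast
      show "tp L M ys (at (a (h' l)) i) \<in> ?P" for l using h'[of l] by (simp add: S_def ok_def)
      show "f (tp L N ys (a (h' l))) j = f (tp L M ys (at (a (h' l)) i)) j"
        if "j < n (s i)" for l j
        using h'[of l] agree_t[of "s i" "h' l" i] that by (simp add: S_def agree_def)
    qed (use a tpN h'F real in auto)
    then obtain c where c: "c \<in> valuations M"
      "\<And>l. l < s i \<Longrightarrow> sat M (override_on (at (a (h' l)) i) c (set xs)) \<phi>"
      unfolding realized_family by blast
    have "sat M (override_on (at (a \<alpha>) i) c (set xs)) \<phi>" if "\<alpha> \<in> S i" for \<alpha>
    proof -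
      have "\<alpha> \<in> h ` {..<s i}" using that h by simp
      then obtain l where "l < s i" "\<alpha> = h l" by auto
      then show ?thesis using c(2)[of l] by (simp add: h'_def)
    qed
    then show ?thesis using c(1) by blast
  qed
  then obtain c where c: "\<And>i. c i \<in> valuations M"
    "\<And>i \<alpha>. i \<in> I \<Longrightarrow> \<alpha> \<in> S i \<Longrightarrow> sat M (override_on (at (a \<alpha>) i) (c i) (set xs)) \<phi>"
    by metis
  show "realized N xs {(\<phi>, a \<alpha>) |\<alpha>. \<alpha> \<in> Field lam}"
  proof (rule realized_pointwise[where b = c])
    show "wf_fm L \<phi>" using \<phi> by (simp add: formulas_def)
    fix \<alpha> assume \<alpha>: "\<alpha> \<in> Field lam"
    \<comment> \<open>Dropping bad parameters is harmless: each \<alpha> still belongs to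
      \<open>S i\<close> for almost all \<open>i\<close>.\<close>
    have "{i\<in>I. s i < t \<alpha> i \<and> ok \<alpha> i} \<in> D"
      using s(2) ok \<alpha> by (simp add: ultrafilter_on_Collect_conj[OF D])
    from ultrafilter_on_Int[OF D X[OF \<alpha>] this]
    show "{i\<in>I. sat M (override_on (at (a \<alpha>) i) (c i) (set xs)) \<phi>} \<in> D"
      by (rule ultrafilter_on_mono[OF D]) (use c(2) \<alpha> in \<open>auto simp: S_def\<close>)
  qed (use a c in auto)
qed

end
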